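(* Let $c \geq 1$ be a fixed integer. There is an infinite family of Boolean functions such that each function of the family on $n$ variables can be computed by an SDD of size $O(n^3)$, while the smallest $c$-NSOBDD computing it has size $n^{\Omega(\log n)}$.
   Context: A vtree over a set of variables $X$ is a full binary tree whose leaves are in bijection with $X$. A sentential decision diagram (SDD) respecting a vtree node $v$ is either a constant (true/false), or, if $v$ is a leaf, a literal of the variable of $v$, or, if $v$ is internal with left child subtree $v_l$ and right child subtree $v_r$, a decision node $\{(p_1,s_1),\dots,(p_m,s_m)\}$ where each prime $p_i$ is an SDD respecting a node in the subtree of $v_l$, each sub $s_i$ is an SDD respecting a node in the subtree of $v_r$, the functions of the primes are each satisfiable, pairwise mutually exclusive, and their disjunction is a tautology; it represents $\bigvee_i (p_i \wedge s_i)$. The size of an SDD is the total number of elements $(p_i,s_i)$ over its distinct decision nodes. A non-deterministic branching program is a directed acyclic graph with one root and one leaf, some of whose edges are labelled by literals of variables. A path is consistent if it does not contain two edges labelled by opposite literals of the same variable; a consistent root-leaf path is a computational path. The program computes $F$: an assignment $S$ (as a set of literals) satisfies $F$ iff some computational path has all its labels in $S$. A $c$-NSOBDD is such a program for which there is a permutation $SV$ of its variables such that every computational path $P$ can be written as $P=P_1+\dots+P_c$ (concatenation of subpaths) where on each $P_i$ each variable occurs at most once and the labels along $P_i$ are ordered according to $SV$. Size is the number of nodes. *)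

theory Defs
  imports Complex_Main
begin

text \<open>Variables are natural numbers; an assignment is a total map nat => bool.
  A Boolean function on the variables {0..<n} is a function of assignments
  that depends only on the variables below n.\<close>

definition depends_only_on :: "nat set \<Rightarrow> ((nat \<Rightarrow> bool) \<Rightarrow> bool) \<Rightarrow> bool" where
  "depends_only_on X F \<longleftrightarrow> (\<forall>\<sigma> \<sigma>'. (\<forall>x\<in>X. \<sigma> x = \<sigma>' x) \<longrightarrow> F \<sigma> = F \<sigma>')"

datatype vtree = VLeaf nat | VNode vtree vtree

primrec vleaves :: "vtree \<Rightarrow> nat list" where
  "vleaves (VLeaf x) = [x]"
| "vleaves (VNode l r) = vleaves l @ vleaves r"

definition vtree_over :: "vtree \<Rightarrow> nat set \<Rightarrow> bool" where
  "vtree_over T X \<longleftrightarrow> distinct (vleaves T) \<and> set (vleaves T) = X"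

primrec vsubtrees :: "vtree \<Rightarrow> vtree set" where
  "vsubtrees (VLeaf x) = {VLeaf x}"
| "vsubtrees (VNode l r) = insert (VNode l r) (vsubtrees l \<union> vsubtrees r)"

datatype sdd = STrue | SFalse | SLit nat bool | SDec "(sdd \<times> sdd) list"

fun sdd_eval :: "sdd \<Rightarrow> (nat \<Rightarrow> bool) \<Rightarrow> bool" where
  "sdd_eval STrue \<sigma> = True"
| "sdd_eval SFalse \<sigma> = False"
| "sdd_eval (SLit x b) \<sigma> = (\<sigma> x = b)"
| "sdd_eval (SDec ps) \<sigma> = (\<exists>e\<in>set ps. sdd_eval (fst e) \<sigma> \<and> sdd_eval (snd e) \<sigma>)"

definition primes_partition :: "(sdd \<times> sdd) list \<Rightarrow> bool" where
  "primes_partition ps \<longleftrightarrow>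
     (\<forall>i<length ps. \<exists>\<sigma>. sdd_eval (fst (ps ! i)) \<sigma>) \<and>
     (\<forall>i<length ps. \<forall>j<length ps. i \<noteq> j \<longrightarrow>
        (\<forall>\<sigma>. \<not> (sdd_eval (fst (ps ! i)) \<sigma> \<and> sdd_eval (fst (ps ! j)) \<sigma>))) \<and>
     (\<forall>\<sigma>. \<exists>i<length ps. sdd_eval (fst (ps ! i)) \<sigma>)"

inductive sdd_respects :: "vtree \<Rightarrow> sdd \<Rightarrow> bool" where
  resp_true: "sdd_respects v STrue"
| resp_false: "sdd_respects v SFalse"
| resp_lit: "sdd_respects (VLeaf x) (SLit x b)"
| resp_dec: "\<lbrakk> \<forall>e\<in>set ps. (\<exists>u\<in>vsubtrees vl. sdd_respects u (fst e)) \<and>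
                             (\<exists>u\<in>vsubtrees vr. sdd_respects u (snd e));
              primes_partition ps \<rbrakk>
            \<Longrightarrow> sdd_respects (VNode vl vr) (SDec ps)"

inductive sdd_sub :: "sdd \<Rightarrow> sdd \<Rightarrow> bool" where
  sub_refl: "sdd_sub a a"
| sub_prime: "e \<in> set ps \<Longrightarrow> sdd_sub a (fst e) \<Longrightarrow> sdd_sub a (SDec ps)"
| sub_sub: "e \<in> set ps \<Longrightarrow> sdd_sub a (snd e) \<Longrightarrow> sdd_sub a (SDec ps)"

definition sdd_size :: "sdd \<Rightarrow> nat" where
  "sdd_size \<alpha> = (\<Sum>d\<in>{d. sdd_sub d \<alpha> \<and> (\<exists>ps. d = SDec ps)}.
                    (case d of SDec ps \<Rightarrow> length ps | _ \<Rightarrow> 0))"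

text \<open>Edges are triples (source, label, target); a label is either None
  (unlabelled) or Some (x, b), the literal x (b = True) or not x (b = False).\<close>
record nbp =
  nodes :: "nat set"
  edges :: "(nat \<times> (nat \<times> bool) option \<times> nat) set"
  root :: nat
  leaf :: nat

definition nbp_wf :: "nbp \<Rightarrow> bool" where
  "nbp_wf B \<longleftrightarrow>
     finite (nodes B) \<and> finite (edges B) \<and>
     (\<forall>(u,l,v)\<in>edges B. u \<in> nodes B \<and> v \<in> nodes B) \<and>
     acyclic {(u,v). \<exists>l. (u,l,v) \<in> edges B} \<and>
     {v\<in>nodes B. \<not>(\<exists>u l. (u,l,v) \<in> edges B)} = {root B} \<and>
     {u\<in>nodes B. \<not>(\<exists>l v. (u,l,v) \<in> edges B)} = {leaf B}"

fun is_path :: "nbp \<Rightarrow> nat \<Rightarrow> (nat \<times> (nat \<times> bool) option \<times> nat) list \<Rightarrow> nat \<Rightarrow> bool" where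
  "is_path B u [] w = (u = w)"
| "is_path B u (e # es) w = (e \<in> edges B \<and> fst e = u \<and> is_path B (snd (snd e)) es w)"

definition path_labels :: "(nat \<times> (nat \<times> bool) option \<times> nat) list \<Rightarrow> (nat \<times> bool) list" where
  "path_labels P = map the (filter (\<lambda>l. l \<noteq> None) (map (fst \<circ> snd) P))"

definition consistent :: "(nat \<times> (nat \<times> bool) option \<times> nat) list \<Rightarrow> bool" where
  "consistent P \<longleftrightarrow> \<not> (\<exists>x. (x, True) \<in> set (path_labels P) \<and> (x, False) \<in> set (path_labels P))"

definition comp_path :: "nbp \<Rightarrow> (nat \<times> (nat \<times> bool) option \<times> nat) list \<Rightarrow> bool" where
  "comp_path B P \<longleftrightarrow> is_path B (root B) P (leaf B) \<and> consistent P"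

definition nbp_computes :: "nbp \<Rightarrow> nat set \<Rightarrow> ((nat \<Rightarrow> bool) \<Rightarrow> bool) \<Rightarrow> bool" where
  "nbp_computes B X F \<longleftrightarrow>
     (\<forall>\<sigma>. F \<sigma> \<longleftrightarrow> (\<exists>P. comp_path B P \<and> set (path_labels P) \<subseteq> {(x, \<sigma> x) | x. x \<in> X}))"

definition nbp_vars :: "nbp \<Rightarrow> nat set" where
  "nbp_vars B = {x. \<exists>u b v. (u, Some (x, b), v) \<in> edges B}"

definition ordered_by :: "nat list \<Rightarrow> (nat \<times> (nat \<times> bool) option \<times> nat) list \<Rightarrow> bool" where
  "ordered_by SV Q \<longleftrightarrow>
     sorted_wrt (\<lambda>a b. \<exists>i j. i < j \<and> j < length SV \<and> SV ! i = fst a \<and> SV ! j = fst b)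
       (path_labels Q)"

definition c_nsobdd :: "nat \<Rightarrow> nbp \<Rightarrow> bool" where
  "c_nsobdd c B \<longleftrightarrow> nbp_wf B \<and>
     (\<exists>SV. distinct SV \<and> set SV = nbp_vars B \<and>
        (\<forall>P. comp_path B P \<longrightarrow>
           (\<exists>Ps. length Ps = c \<and> concat Ps = P \<and> (\<forall>Q\<in>set Ps. ordered_by SV Q))))"

definition nbp_size :: "nbp \<Rightarrow> nat" where
  "nbp_size B = card (nodes B)"

end

(* The function lives on a complete ternary tree of height h whose nodes carry a clump of 2L
   variables and a selector, with L = 2^h; it demands, for every edge (u, w) whose selector (kept at
   the child w) is on, that the clumps of u and w together contain at most L ones.  Conditioning on
   the number of ones in the root clump makes the subtrees independent, which gives small SDDs.
   For the lower bound, cut the variable order of a c-NSOBDD anywhere: each accepting path crosses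
   the cut at most 2c - 1 times, so a fooling set for the cut has size at most s^(2c).  As in the
   logarithmic lower bound for the pathwidth of trees, some cut has h disjoint tree edges of
   which one end has half of its clump before the cut and the other end half of its clump after it;
   this yields a fooling set of size (L + 1)^h, where h and log L are both of order log n. *)

theory Submission
  imports Defs "HOL-Library.FuncSet"
begin

section \<open>Counting SDDs\<close>

text \<open>A vtree may branch along the tree, whereas a program follows a linear order that is not
  known in advance, so no fixed set of edges is sure to be cut by it. Hence every edge carries a
  potential constraint, and the selectors pick afterwards those edges that the order happens to cut;
  all other constraints vanish and the matched edges become independent. A clump has 2L variables
  against a threshold L because one side of the cut is only guaranteed half of it, and this half
  must still realise every count from 0 to L. With k ones at one end of an edge and L - k' at the
  other, the constraint reads k <= k'. Accepting both mixtures of two assignments therefore forces k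
  = k', and each edge contributes a factor L + 1. On the SDD side the danger is repeated branching
  over the clump counts. A subtree depends on its surroundings only through one number, the count of
  its parent, so its SDDs are shared by all contexts. Primes must partition, so negations are needed
  as well; each SDD is built in both polarities.\<close>

definition sdd_const :: "bool \<Rightarrow> sdd" where
  "sdd_const p = (if p then STrue else SFalse)"

lemma sdd_eval_const [simp]: "sdd_eval (sdd_const p) \<sigma> = p"
  by (simp add: sdd_const_def)

lemma sdd_respects_const [simp]: "sdd_respects v (sdd_const p)"
  by (simp add: sdd_const_def resp_true resp_false)

lemma vsubtrees_refl [simp]: "v \<in> vsubtrees v"
  by (cases v) auto

lemma primes_partition_alt:
  "primes_partition ps \<longleftrightarrow>
     (\<forall>e\<in>set ps. \<exists>\<sigma>. sdd_eval (fst e) \<sigma>) \<and>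
     (\<forall>i<length ps. \<forall>j<length ps. i \<noteq> j \<longrightarrow>
        (\<forall>\<sigma>. \<not> (sdd_eval (fst (ps ! i)) \<sigma> \<and> sdd_eval (fst (ps ! j)) \<sigma>))) \<and>
     (\<forall>\<sigma>. \<exists>e\<in>set ps. sdd_eval (fst e) \<sigma>)"
  unfolding primes_partition_def set_conv_nth by blast

lemma primes_partition_pair:
  assumes "\<exists>\<sigma>. sdd_eval p \<sigma>" "\<exists>\<sigma>. sdd_eval q \<sigma>" "\<And>\<sigma>. sdd_eval q \<sigma> \<longleftrightarrow> \<not> sdd_eval p \<sigma>"
  shows "primes_partition [(p, s), (q, t)]"
  using assms by (auto simp: primes_partition_alt less_Suc_eq)

lemma primes_partition_map_upt:
  assumes "\<And>b. b < m \<Longrightarrow> \<exists>\<sigma>. f \<sigma> = b"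
    and "\<And>b \<sigma>. sdd_eval (p b) \<sigma> \<longleftrightarrow> f \<sigma> = b"
    and "\<And>\<sigma>. f \<sigma> < m"
  shows "primes_partition (map (\<lambda>b. (p b, s b)) [0..<m])"
proof -
  have "\<exists>\<sigma>. sdd_eval (p b) \<sigma>" if "b < m" for b
    using assms that by blast
  moreover have "\<exists>b\<in>{0..<m}. sdd_eval (p b) \<sigma>" for \<sigma>
    using assms(2)[of _ \<sigma>] assms(3)[of \<sigma>] by force
  moreover have "\<not> (sdd_eval (p i) \<sigma> \<and> sdd_eval (p j) \<sigma>)" if "i \<noteq> j" for i j \<sigma>
    using that by (simp add: assms(2))
  ultimately show ?thesis
    by (auto simp: primes_partition_alt)
qed

lemma sdd_respects_pair:
  assumes "\<exists>u\<in>vsubtrees vl. sdd_respects u p" "\<exists>u\<in>vsubtrees vl. sdd_respects u q"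
    and "\<exists>u\<in>vsubtrees vr. sdd_respects u s" "\<exists>u\<in>vsubtrees vr. sdd_respects u t"
    and "\<exists>\<sigma>. sdd_eval p \<sigma>" "\<exists>\<sigma>. sdd_eval q \<sigma>" "\<And>\<sigma>. sdd_eval q \<sigma> \<longleftrightarrow> \<not> sdd_eval p \<sigma>"
  shows "sdd_respects (VNode vl vr) (SDec [(p, s), (q, t)])"
  using assms by (intro resp_dec primes_partition_pair) auto

text \<open>Distinctness of nodes is equality of terms, so equal sub-SDDs are shared automatically.
  Bounding a size amounts to finding a finite superset of this set whose weight is easy to
  sum.\<close>

definition dnodes :: "sdd \<Rightarrow> sdd set" where
  "dnodes \<alpha> = {d. sdd_sub d \<alpha> \<and> (\<exists>ps. d = SDec ps)}"

definition sdd_weight :: "sdd \<Rightarrow> nat" where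
  "sdd_weight d = (case d of SDec ps \<Rightarrow> length ps | _ \<Rightarrow> 0)"

lemma sdd_weight_SDec [simp]: "sdd_weight (SDec ps) = length ps"
  by (simp add: sdd_weight_def)

lemma sdd_size_dnodes: "sdd_size \<alpha> = sum sdd_weight (dnodes \<alpha>)"
  by (simp add: sdd_size_def dnodes_def sdd_weight_def)

lemma dnodes_simps [simp]:
  "dnodes STrue = {}" "dnodes SFalse = {}" "dnodes (SLit x b) = {}"
  "dnodes (SDec ps) = insert (SDec ps) (\<Union>e\<in>set ps. dnodes (fst e) \<union> dnodes (snd e))"
proof -
  show "dnodes STrue = {}" "dnodes SFalse = {}" "dnodes (SLit x b) = {}"
    by (auto simp: dnodes_def elim: sdd_sub.cases)
  have "sdd_sub d (SDec ps) \<longleftrightarrow> d = SDec ps \<or> (\<exists>e\<in>set ps. sdd_sub d (fst e) \<or> sdd_sub d (snd e))" for d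
    by (auto elim: sdd_sub.cases intro: sdd_sub.intros)
  then show "dnodes (SDec ps) = insert (SDec ps) (\<Union>e\<in>set ps. dnodes (fst e) \<union> dnodes (snd e))"
    by (auto simp: dnodes_def)
qed

lemma dnodes_const [simp]: "dnodes (sdd_const p) = {}"
  by (simp add: sdd_const_def)

section \<open>Number of ones in an interval of variables\<close>

definition ones :: "nat \<Rightarrow> nat \<Rightarrow> (nat \<Rightarrow> bool) \<Rightarrow> nat" where
  "ones x m \<sigma> = card {i \<in> {x..<x + m}. \<sigma> i}"

lemma ones_0 [simp]: "ones x 0 \<sigma> = 0"
  by (simp add: ones_def)

lemma ones_Suc: "ones x (Suc m) \<sigma> = of_bool (\<sigma> x) + ones (Suc x) m \<sigma>"
proof -
  have "{i \<in> {x..<x + Suc m}. \<sigma> i} = (if \<sigma> x then {x} else {}) \<union> {i \<in> {Suc x..<Suc x + m}. \<sigma> i}"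
    by (auto simp: le_less Suc_le_eq)
  also have "card \<dots> = of_bool (\<sigma> x) + card {i \<in> {Suc x..<Suc x + m}. \<sigma> i}"
    by (subst card_Un_disjoint) auto
  finally show ?thesis by (simp add: ones_def)
qed

lemma ones_True: "ones x m (\<lambda>_. True) = m"
  by (induction m arbitrary: x) (simp_all add: ones_Suc)

lemma ones_le: "ones x m \<sigma> \<le> m"
  unfolding ones_def by (rule order.trans[OF card_mono[of "{x..<x+m}"]]) auto

lemma ones_cong: "(\<And>i. x \<le> i \<Longrightarrow> i < x + m \<Longrightarrow> \<sigma> i = \<tau> i) \<Longrightarrow> ones x m \<sigma> = ones x m \<tau>"
  unfolding ones_def by (rule arg_cong[where f = card]) auto

lemma ones_eq_ex: "b \<le> m \<Longrightarrow> \<exists>\<sigma>. ones x m \<sigma> = b"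
proof (rule exI)
  assume "b \<le> m"
  then have "{i \<in> {x..<x + m}. i < x + b} = {x..<x + b}" by auto
  then show "ones x m (\<lambda>i. i < x + b) = b" by (simp add: ones_def)
qed

text \<open>Since a vtree has at least one leaf, the argument m stands for Suc m variables.\<close>

fun count_vtree :: "nat \<Rightarrow> nat \<Rightarrow> vtree" where
  "count_vtree 0 x = VLeaf x"
| "count_vtree (Suc m) x = VNode (VLeaf x) (count_vtree m (Suc x))"

text \<open>The test \<open>b = 0\<close> guards against truncated subtraction. Targets above the
  number of variables are allowed and give unsatisfiable SDDs.\<close>

fun count_sdd :: "nat \<Rightarrow> nat \<Rightarrow> nat \<Rightarrow> sdd" where
  "count_sdd 0 x b = (if b = 0 then SLit x False else if b = 1 then SLit x True else SFalse)"
| "count_sdd (Suc m) x b =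
     SDec [(SLit x False, count_sdd m (Suc x) b),
           (SLit x True, if b = 0 then SFalse else count_sdd m (Suc x) (b - 1))]"

lemma vleaves_count_vtree: "vleaves (count_vtree m x) = [x..<x + Suc m]"
  by (induction m arbitrary: x) (simp_all add: upt_rec)

lemma sdd_eval_count: "sdd_eval (count_sdd m x b) \<sigma> \<longleftrightarrow> ones x (Suc m) \<sigma> = b"
proof (induction m arbitrary: x b)
  case 0
  show ?case by (auto simp: ones_Suc)
next
  case (Suc m)
  show ?case by (cases b) (auto simp: Suc.IH ones_Suc[of x "Suc m"])
qed

lemma sdd_respects_lit: "\<exists>u\<in>vsubtrees (VLeaf x). sdd_respects u (SLit x b)"
  by (simp add: resp_lit)

lemma sat_lit: "\<exists>\<sigma>. sdd_eval (SLit x b) \<sigma>"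
  by (rule exI[of _ "\<lambda>_. b"]) simp

lemma sdd_respects_count: "sdd_respects (count_vtree m x) (count_sdd m x b)"
proof (induction m arbitrary: x b)
  case 0
  show ?case by (auto intro: sdd_respects.intros)
next
  case (Suc m)
  have "\<exists>u\<in>vsubtrees (count_vtree m (Suc x)). sdd_respects u (count_sdd m (Suc x) b')" for b'
    using Suc.IH vsubtrees_refl by blast
  moreover have "\<exists>u\<in>vsubtrees (count_vtree m (Suc x)). sdd_respects u SFalse"
    using resp_false vsubtrees_refl by blast
  ultimately show ?case
    unfolding count_vtree.simps count_sdd.simps
    by (intro sdd_respects_pair sdd_respects_lit sat_lit) auto
qed

text \<open>The target never grows on the way down, so the count SDDs for all targets up to
  \<open>B\<close> lie in one family with at most \<open>B + 1\<close> nodes per level. This sharing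
  keeps the contribution of a clump quadratic.\<close>

primrec count_nodes :: "nat \<Rightarrow> nat \<Rightarrow> nat \<Rightarrow> sdd set" where
  "count_nodes B 0 x = {}"
| "count_nodes B (Suc m) x = count_sdd (Suc m) x ` {..B} \<union> count_nodes B m (Suc x)"

lemma dnodes_count_sdd: "b \<le> B \<Longrightarrow> dnodes (count_sdd m x b) \<subseteq> count_nodes B m x"
proof (induction m arbitrary: x b)
  case (Suc m)
  have "dnodes (count_sdd m (Suc x) b') \<subseteq> count_nodes B m (Suc x)" if "b' \<le> b" for b'
    using that Suc by simp
  from this[of b] this[of "b - 1"] show ?case
    using Suc.prems by auto
qed simp

lemma finite_count_nodes [simp]: "finite (count_nodes B m x)"
  by (induction m arbitrary: x) auto

lemma sum_union_le:
  fixes f :: "'a \<Rightarrow> nat"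
  shows "finite A \<Longrightarrow> finite B \<Longrightarrow> sum f (A \<union> B) \<le> sum f A + sum f B"
  by (simp add: sum_Un_nat)

lemma sum_image_le_card:
  fixes f :: "'a \<Rightarrow> nat"
  assumes "finite I" "\<And>i. i \<in> I \<Longrightarrow> f (g i) \<le> k" "card I \<le> n"
  shows "sum f (g ` I) \<le> n * k"
proof -
  have "sum f (g ` I) \<le> of_nat (card (g ` I)) * k"
    by (rule sum_bounded_above) (use assms in auto)
  also have "\<dots> \<le> n * k"
    using card_image_le[OF assms(1), of g] assms(3) by simp
  finally show ?thesis .
qed

lemma weight_count_nodes: "sum sdd_weight (count_nodes B m x) \<le> 2 * m * Suc B"
proof (induction m arbitrary: x)
  case (Suc m)
  have "sum sdd_weight (count_nodes B (Suc m) x)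
      \<le> sum sdd_weight (count_sdd (Suc m) x ` {..B}) + sum sdd_weight (count_nodes B m (Suc x))"
    by (simp only: count_nodes.simps) (rule sum_union_le, auto)
  also have "sum sdd_weight (count_sdd (Suc m) x ` {..B}) \<le> Suc B * 2"
    by (rule sum_image_le_card) auto
  finally show ?case using Suc[of "Suc x"] by simp
qed simp

section \<open>SDDs for the tree function\<close>

text \<open>Complete ternary trees, with nodes numbered in preorder: the tree of height h rooted at v
  consists of the nodes v, ..., v + tree_size h - 1.\<close>

primrec tree_size :: "nat \<Rightarrow> nat" where
  "tree_size 0 = 1"
| "tree_size (Suc h) = Suc (3 * tree_size h)"

definition child :: "nat \<Rightarrow> nat \<Rightarrow> nat \<Rightarrow> nat" where
  "child h v i = Suc v + i * tree_size h"

primrec tree_edges :: "nat \<Rightarrow> nat \<Rightarrow> (nat \<times> nat) set" where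
  "tree_edges 0 v = {}"
| "tree_edges (Suc h) v = (\<Union>i<3. insert (v, child h v i) (tree_edges h (child h v i)))"

text \<open>\<open>P p\<close> is meant to represent "f equals p". If f fails, so does the
  conjunction, which then equals p exactly for \<open>p = False\<close>; this explains the constant
  \<open>\<not> p\<close>. The two primes are the reason why both polarities of f are
  needed.\<close>

definition and_sdd :: "(bool \<Rightarrow> sdd) \<Rightarrow> (bool \<Rightarrow> sdd) \<Rightarrow> bool \<Rightarrow> sdd" where
  "and_sdd P Q p = SDec [(P True, Q p), (P False, sdd_const (\<not> p))]"

definition imp_sdd :: "nat \<Rightarrow> bool \<Rightarrow> (bool \<Rightarrow> sdd) \<Rightarrow> bool \<Rightarrow> sdd" where
  "imp_sdd z ok Q p = SDec [(SLit z False, Q p), (SLit z True, if ok then Q p else sdd_const (\<not> p))]"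

lemma sdd_eval_and:
  assumes "\<And>p. sdd_eval (P p) \<sigma> \<longleftrightarrow> f = p" "\<And>p. sdd_eval (Q p) \<sigma> \<longleftrightarrow> g = p"
  shows "sdd_eval (and_sdd P Q p) \<sigma> \<longleftrightarrow> (f \<and> g) = p"
  using assms by (auto simp: and_sdd_def)

lemma sdd_eval_imp:
  assumes "\<And>p. sdd_eval (Q p) \<sigma> \<longleftrightarrow> g = p"
  shows "sdd_eval (imp_sdd z ok Q p) \<sigma> \<longleftrightarrow> ((\<sigma> z \<longrightarrow> ok) \<and> g) = p"
  using assms by (auto simp: imp_sdd_def)

lemma sdd_respects_and:
  assumes "\<And>p. sdd_respects l (P p)" "\<And>p. sdd_respects r (Q p)"
    and "\<And>p \<sigma>. sdd_eval (P p) \<sigma> \<longleftrightarrow> f \<sigma> = p" "\<And>p. \<exists>\<sigma>. f \<sigma> = p"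
  shows "sdd_respects (VNode l r) (and_sdd P Q p)"
  unfolding and_sdd_def
proof (rule sdd_respects_pair)
  show "\<exists>\<sigma>. sdd_eval (P True) \<sigma>" "\<exists>\<sigma>. sdd_eval (P False) \<sigma>"
    using assms(4)[of True] assms(4)[of False] by (simp_all add: assms(3))
qed (auto intro: bexI[OF _ vsubtrees_refl] vsubtrees_refl assms(1,2) simp: assms(3))

lemma sdd_respects_imp:
  assumes "\<And>p. sdd_respects r (Q p)"
  shows "sdd_respects (VNode (VLeaf z) r) (imp_sdd z ok Q p)"
  unfolding imp_sdd_def
  by (rule sdd_respects_pair; (rule sdd_respects_lit sat_lit bexI[OF _ vsubtrees_refl])?)
     (simp_all add: assms)

context
  fixes L :: nat
  assumes L: "0 < L"
begin

text \<open>Node v owns a block of 2L + 1 consecutive variables: its clump, followed by its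
  selector.\<close>

definition sel :: "nat \<Rightarrow> nat" where
  "sel v = v * Suc (2 * L) + 2 * L"

definition clump_count :: "nat \<Rightarrow> (nat \<Rightarrow> bool) \<Rightarrow> nat" where
  "clump_count v = ones (v * Suc (2 * L)) (2 * L)"

text \<open>\<open>a\<close> stands for the number of ones in the clump of the parent: the edge
  above v is charged to v, and the recursion closes on a single number. At the root
  \<open>a = 0\<close>, so that its selector merely asks for at most L ones in its own
  clump.\<close>

definition tree_fun :: "nat \<Rightarrow> nat \<Rightarrow> nat \<Rightarrow> (nat \<Rightarrow> bool) \<Rightarrow> bool" where
  "tree_fun h v a \<sigma> \<longleftrightarrow> (\<sigma> (sel v) \<longrightarrow> a + clump_count v \<sigma> \<le> L) \<and>
     (\<forall>(u, w)\<in>tree_edges h v. \<sigma> (sel w) \<longrightarrow> clump_count u \<sigma> + clump_count w \<sigma> \<le> L)"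

lemma clump_count_le: "clump_count v \<sigma> \<le> 2 * L"
  by (simp add: clump_count_def ones_le)

lemma tree_fun_0: "tree_fun 0 v a \<sigma> \<longleftrightarrow> (\<sigma> (sel v) \<longrightarrow> a + clump_count v \<sigma> \<le> L)"
  by (simp add: tree_fun_def)

lemma less_3_iff: "i < 3 \<longleftrightarrow> i = 0 \<or> i = 1 \<or> i = (2::nat)"
  by auto

lemma tree_fun_Suc:
  "tree_fun (Suc h) v a \<sigma> \<longleftrightarrow> (\<sigma> (sel v) \<longrightarrow> a + clump_count v \<sigma> \<le> L) \<and>
     (tree_fun h (child h v 0) (clump_count v \<sigma>) \<sigma> \<and>
      tree_fun h (child h v 1) (clump_count v \<sigma>) \<sigma> \<and>
      tree_fun h (child h v 2) (clump_count v \<sigma>) \<sigma>)"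
proof -
  have "(\<forall>i<3. tree_fun h (child h v i) (clump_count v \<sigma>) \<sigma>) \<longleftrightarrow>
     (\<forall>(u, w)\<in>tree_edges (Suc h) v. \<sigma> (sel w) \<longrightarrow> clump_count u \<sigma> + clump_count w \<sigma> \<le> L)"
    by (auto simp: tree_fun_def)
  then have "tree_fun (Suc h) v a \<sigma> \<longleftrightarrow> (\<sigma> (sel v) \<longrightarrow> a + clump_count v \<sigma> \<le> L) \<and>
      (\<forall>i<3. tree_fun h (child h v i) (clump_count v \<sigma>) \<sigma>)"
    unfolding tree_fun_def[of "Suc h"] by blast
  then show ?thesis
    by (auto simp: less_3_iff)
qed

lemma tree_fun_all_False: "tree_fun h v a (\<lambda>_. False)"
  by (auto simp: tree_fun_def)

lemma not_tree_fun_all_True: "\<not> tree_fun h v a (\<lambda>_. True)"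
  using L by (simp add: tree_fun_def clump_count_def ones_True)

text \<open>SDDs of the children serve as primes in both polarities, and primes have to be
  satisfiable. Switching everything on violates the condition at the root because 2L > L.\<close>

lemma tree_fun_sat: "\<exists>\<sigma>. tree_fun h v a \<sigma> = p"
  using tree_fun_all_False[of h v a] not_tree_fun_all_True[of h v a] by (cases p) blast+

definition clump_vtree :: "nat \<Rightarrow> vtree" where
  "clump_vtree v = count_vtree (2 * L - 1) (v * Suc (2 * L))"

definition clump_sdd :: "nat \<Rightarrow> nat \<Rightarrow> sdd" where
  "clump_sdd v = count_sdd (2 * L - 1) (v * Suc (2 * L))"

lemma sdd_eval_clump: "sdd_eval (clump_sdd v b) \<sigma> \<longleftrightarrow> clump_count v \<sigma> = b"
  using L by (simp add: clump_sdd_def sdd_eval_count clump_count_def)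

lemma sdd_respects_clump: "sdd_respects (clump_vtree v) (clump_sdd v b)"
  by (simp add: clump_sdd_def clump_vtree_def sdd_respects_count)

text \<open>The clump stands to the left of everything else so that its count can be the prime;
  selector and subtrees then see a fixed count.\<close>

primrec tree_vtree :: "nat \<Rightarrow> nat \<Rightarrow> vtree" where
  "tree_vtree 0 v = VNode (clump_vtree v) (VLeaf (sel v))"
| "tree_vtree (Suc h) v = VNode (clump_vtree v) (VNode (VLeaf (sel v))
     (VNode (tree_vtree h (child h v 0)) (VNode (tree_vtree h (child h v 1)) (tree_vtree h (child h v 2)))))"

text \<open>The Boolean argument p is the polarity: the SDD represents the function for p = True
  and its complement for p = False.\<close>

primrec tree_sdd :: "nat \<Rightarrow> nat \<Rightarrow> nat \<Rightarrow> bool \<Rightarrow> sdd" where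
  "tree_sdd 0 v a p = SDec (map (\<lambda>b. (clump_sdd v b,
      if a + b \<le> L then sdd_const p else SLit (sel v) (\<not> p))) [0..<Suc (2 * L)])"
| "tree_sdd (Suc h) v a p = SDec (map (\<lambda>b. (clump_sdd v b,
      imp_sdd (sel v) (a + b \<le> L)
        (and_sdd (tree_sdd h (child h v 0) b)
          (and_sdd (tree_sdd h (child h v 1) b) (tree_sdd h (child h v 2) b))) p)) [0..<Suc (2 * L)])"

text \<open>Preorder numbering together with the block layout lists the leaves in increasing order,
  so distinctness and the exact variable set are immediate.\<close>

lemma vleaves_tree_vtree:
  "vleaves (tree_vtree h v) = [v * Suc (2 * L)..<(v + tree_size h) * Suc (2 * L)]"
proof -
  have app: "[a..<b] @ [b..<c] = [a..<c]" if "a \<le> b" "b \<le> c" for a b c :: nat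
    using that by (metis le_add_diff_inverse upt_add_eq_append)
  have clump: "vleaves (clump_vtree v) @ sel v # xs = [v * Suc (2 * L)..<(v + 1) * Suc (2 * L)] @ xs" for v xs
  proof -
    have "vleaves (clump_vtree v) @ [sel v] = [v * Suc (2 * L)..<(v + 1) * Suc (2 * L)]"
      using L by (simp add: clump_vtree_def vleaves_count_vtree sel_def add_ac)
    then show ?thesis by simp
  qed
  show ?thesis
  proof (induction h arbitrary: v)
    case 0
    show ?case using clump[of v "[]"] by simp
  next
    case (Suc h)
    let ?K = "Suc (2 * L)" and ?s = "tree_size h"
    have c: "child h v 0 = v + 1" "child h v 1 = v + 1 + ?s" "child h v 2 = v + 1 + ?s + ?s"
      by (simp_all add: child_def)
    have e: "v + tree_size (Suc h) = v + 1 + ?s + ?s + ?s"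
      by simp
    have "vleaves (tree_vtree (Suc h) v) = [v * ?K..<(v + 1) * ?K] @ [(v + 1) * ?K..<(v + 1 + ?s) * ?K] @
        [(v + 1 + ?s) * ?K..<(v + 1 + ?s + ?s) * ?K] @
        [(v + 1 + ?s + ?s) * ?K..<(v + 1 + ?s + ?s + ?s) * ?K]"
      unfolding tree_vtree.simps vleaves.simps Suc.IH append.simps clump c ..
    also have "\<dots> = [v * ?K..<(v + 1 + ?s + ?s + ?s) * ?K]"
      by (simp only: app mult_le_mono1 trans_le_add1 le_add1)
    finally show ?case unfolding e .
  qed
qed

lemma vtree_over_tree_vtree: "vtree_over (tree_vtree h 0) {0..<tree_size h * Suc (2 * L)}"
  by (simp add: vtree_over_def vleaves_tree_vtree)

lemma sdd_eval_map:
  assumes "\<And>b. sdd_eval (p b) \<sigma> \<longleftrightarrow> k = b" "k < m"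
  shows "sdd_eval (SDec (map (\<lambda>b. (p b, s b)) [0..<m])) \<sigma> \<longleftrightarrow> sdd_eval (s k) \<sigma>"
  using assms by auto

lemma sdd_eval_tree: "sdd_eval (tree_sdd h v a p) \<sigma> \<longleftrightarrow> tree_fun h v a \<sigma> = p"
proof (induction h arbitrary: v a p)
  case 0
  show ?case unfolding tree_sdd.simps
    by (subst sdd_eval_map, rule sdd_eval_clump)
       (auto simp: less_Suc_eq_le clump_count_le tree_fun_0)
next
  case (Suc h)
  show ?case unfolding tree_sdd.simps
    by (subst sdd_eval_map, rule sdd_eval_clump, simp add: less_Suc_eq_le clump_count_le,
        unfold tree_fun_Suc, intro sdd_eval_imp sdd_eval_and Suc.IH)
qed

lemma primes_partition_clump:
  "primes_partition (map (\<lambda>b. (clump_sdd v b, s b)) [0..<Suc (2 * L)])"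
proof (rule primes_partition_map_upt[where f = "clump_count v"])
  show "\<exists>\<sigma>. clump_count v \<sigma> = b" if "b < Suc (2 * L)" for b
    using that ones_eq_ex[of b "2 * L"] by (simp add: clump_count_def)
qed (simp_all add: sdd_eval_clump less_Suc_eq_le clump_count_le)

lemma sdd_respects_tree: "sdd_respects (tree_vtree h v) (tree_sdd h v a p)"
proof (induction h arbitrary: v a p)
  case 0
  have "\<exists>u\<in>vsubtrees (VLeaf (sel v)).
      sdd_respects u (if a + b \<le> L then sdd_const p else SLit (sel v) (\<not> p))" for b
    by (simp add: resp_lit)
  then show ?case unfolding tree_sdd.simps tree_vtree.simps
    by (intro resp_dec primes_partition_clump ballI conjI bexI[OF _ vsubtrees_refl])
       (auto intro: sdd_respects_clump simp del: upt_Suc)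
next
  case (Suc h)
  have conj: "sdd_respects (VNode (tree_vtree h (child h v 0))
      (VNode (tree_vtree h (child h v 1)) (tree_vtree h (child h v 2))))
      (and_sdd (tree_sdd h (child h v 0) b)
          (and_sdd (tree_sdd h (child h v 1) b) (tree_sdd h (child h v 2) b)) p)" for b p
    by (intro sdd_respects_and[OF Suc.IH _ sdd_eval_tree tree_fun_sat] Suc.IH)
  show ?case unfolding tree_sdd.simps tree_vtree.simps
    by (intro resp_dec primes_partition_clump ballI conjI bexI[OF _ vsubtrees_refl])
       (auto intro!: sdd_respects_clump sdd_respects_imp[OF conj] simp del: upt_Suc One_nat_def)
qed

section \<open>Size of the SDD of the tree function\<close>

definition tree_rest :: "nat \<Rightarrow> nat \<Rightarrow> nat \<Rightarrow> bool \<Rightarrow> sdd" where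
  "tree_rest h v b = and_sdd (tree_sdd h (child h v 1) b) (tree_sdd h (child h v 2) b)"

definition tree_conj :: "nat \<Rightarrow> nat \<Rightarrow> nat \<Rightarrow> bool \<Rightarrow> sdd" where
  "tree_conj h v b = and_sdd (tree_sdd h (child h v 0) b) (tree_rest h v b)"

definition clump_nodes :: "nat \<Rightarrow> sdd set" where
  "clump_nodes v = count_nodes (2 * L) (2 * L - 1) (v * Suc (2 * L))"

definition root_nodes :: "nat \<Rightarrow> nat \<Rightarrow> sdd set" where
  "root_nodes h v = (\<lambda>(a, p). tree_sdd h v a p) ` ({..2 * L} \<times> UNIV)"

definition branch_nodes :: "nat \<Rightarrow> nat \<Rightarrow> sdd set" where
  "branch_nodes h v =
     (\<lambda>((a, b), p). imp_sdd (sel v) (a + b \<le> L) (tree_conj h v b) p) ` (({..2 * L} \<times> {..2 * L}) \<times> UNIV) \<union>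
     ((\<lambda>(b, p). tree_conj h v b p) ` ({..2 * L} \<times> UNIV) \<union>
      (\<lambda>(b, p). tree_rest h v b p) ` ({..2 * L} \<times> UNIV))"

text \<open>The family depends on neither \<open>a\<close> nor \<open>p\<close>. Each level hands 2L
  + 1 counts in two polarities down to the children; if these calls did not meet in one family, the
  size bound would pick up such a factor at every level.\<close>

primrec tree_nodes :: "nat \<Rightarrow> nat \<Rightarrow> sdd set" where
  "tree_nodes 0 v = clump_nodes v \<union> root_nodes 0 v"
| "tree_nodes (Suc h) v = (clump_nodes v \<union> root_nodes (Suc h) v) \<union> (branch_nodes h v \<union>
     (tree_nodes h (child h v 0) \<union> (tree_nodes h (child h v 1) \<union> tree_nodes h (child h v 2))))"

lemma dnodes_clump_sdd: "b \<le> 2 * L \<Longrightarrow> dnodes (clump_sdd v b) \<subseteq> clump_nodes v"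
  by (simp add: clump_sdd_def clump_nodes_def dnodes_count_sdd)

lemma dnodes_map_subset:
  assumes "SDec (map (\<lambda>b. (p b, s b)) [0..<m]) \<in> X"
    and "\<And>b. b < m \<Longrightarrow> dnodes (p b) \<subseteq> X" "\<And>b. b < m \<Longrightarrow> dnodes (s b) \<subseteq> X"
  shows "dnodes (SDec (map (\<lambda>b. (p b, s b)) [0..<m])) \<subseteq> X"
  using assms by (simp add: UN_subset_iff)

lemma dnodes_and: "dnodes (and_sdd P Q p) \<subseteq>
    insert (and_sdd P Q p) (dnodes (P True) \<union> dnodes (P False) \<union> dnodes (Q p))"
  by (auto simp: and_sdd_def)

lemma dnodes_imp: "dnodes (imp_sdd z ok Q p) \<subseteq> insert (imp_sdd z ok Q p) (dnodes (Q p))"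
  by (auto simp: imp_sdd_def split: if_splits)

lemma dnodes_tree_sdd: "a \<le> 2 * L \<Longrightarrow> dnodes (tree_sdd h v a p) \<subseteq> tree_nodes h v"
proof (induction h arbitrary: v a p)
  case 0
  have root: "tree_sdd 0 v a p \<in> root_nodes 0 v"
    using 0 unfolding root_nodes_def by (intro image_eqI[where x = "(a, p)"]) (simp_all only: prod.case, simp)
  show ?case
    unfolding tree_sdd.simps
  proof (rule dnodes_map_subset)
    show "SDec (map (\<lambda>b. (clump_sdd v b, if a + b \<le> L then sdd_const p else SLit (sel v) (\<not> p)))
        [0..<Suc (2 * L)]) \<in> tree_nodes 0 v"
      using root unfolding tree_sdd.simps tree_nodes.simps by (rule UnI2)
    show "dnodes (clump_sdd v b) \<subseteq> tree_nodes 0 v" if "b < Suc (2 * L)" for b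
      using dnodes_clump_sdd[of b v] that by (simp add: le_supI1)
  qed simp
next
  case (Suc h)
  have root: "tree_sdd (Suc h) v a p \<in> root_nodes (Suc h) v"
    using Suc.prems unfolding root_nodes_def
    by (intro image_eqI[where x = "(a, p)"]) (simp_all only: prod.case, simp)
  have sub: "dnodes (imp_sdd (sel v) (a + b \<le> L) (tree_conj h v b) p) \<subseteq> tree_nodes (Suc h) v"
    if b: "b \<le> 2 * L" for b
  proof -
    have IH: "dnodes (tree_sdd h w b q) \<subseteq> tree_nodes h w" for w q
      by (rule Suc.IH[OF b])
    have 1: "tree_rest h v b p \<in> branch_nodes h v" "tree_conj h v b p \<in> branch_nodes h v"
      using b unfolding branch_nodes_def by (auto intro!: image_eqI[where x = "(b, p)"])
    have 2: "imp_sdd (sel v) (a + b \<le> L) (tree_conj h v b) p \<in> branch_nodes h v"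
      using b Suc.prems unfolding branch_nodes_def
        by (intro UnI1 image_eqI[where x = "((a, b), p)"]) simp_all
    have sub: "branch_nodes h v \<subseteq> tree_nodes (Suc h) v"
      "tree_nodes h (child h v 0) \<subseteq> tree_nodes (Suc h) v"
      "tree_nodes h (child h v 1) \<subseteq> tree_nodes (Suc h) v"
      "tree_nodes h (child h v 2) \<subseteq> tree_nodes (Suc h) v"
      by auto
    note IH' = order.trans[OF IH sub(2)] order.trans[OF IH sub(3)] order.trans[OF IH sub(4)]
    have rest: "dnodes (tree_rest h v b p) \<subseteq> tree_nodes (Suc h) v"
      unfolding tree_rest_def
      by (rule order.trans[OF dnodes_and insert_subsetI])
        (use 1(1) sub(1) IH' in \<open>auto simp only: Un_subset_iff tree_rest_def\<close>)
    have conj: "dnodes (tree_conj h v b p) \<subseteq> tree_nodes (Suc h) v"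
      unfolding tree_conj_def
      by (rule order.trans[OF dnodes_and insert_subsetI])
        (use 1(2) sub(1) IH' rest in \<open>auto simp only: Un_subset_iff tree_conj_def\<close>)
    show ?thesis
      by (rule order.trans[OF dnodes_imp insert_subsetI])
        (use 2 sub(1) conj in \<open>auto simp only:\<close>)
  qed
  show ?case
    unfolding tree_sdd.simps
  proof (rule dnodes_map_subset, fold tree_rest_def, fold tree_conj_def)
    show "SDec (map (\<lambda>b. (clump_sdd v b, imp_sdd (sel v) (a + b \<le> L) (tree_conj h v b) p))
        [0..<Suc (2 * L)]) \<in> tree_nodes (Suc h) v"
      using root unfolding tree_sdd.simps tree_nodes.simps tree_conj_def tree_rest_def
      by (intro UnI1 UnI2)
    show "dnodes (clump_sdd v b) \<subseteq> tree_nodes (Suc h) v" if "b < Suc (2 * L)" for b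
      using dnodes_clump_sdd[of b v] that by (simp add: le_supI1)
  qed (simp only: sub less_Suc_eq_le)
qed

lemma finite_tree_nodes: "finite (tree_nodes h v)"
  by (induction h arbitrary: v)
     (simp_all add: clump_nodes_def root_nodes_def branch_nodes_def)

lemma weight_tree_sdd: "sdd_weight (tree_sdd h v a p) = Suc (2 * L)"
  by (cases h) (simp_all del: upt_Suc)

text \<open>The 4 is 2 for the count nodes plus 2 for the root nodes: 2L + 1 values of
  \<open>a\<close> and two polarities, with 2L + 1 elements each.\<close>

lemma weight_clump_root:
  "sum sdd_weight (clump_nodes v \<union> root_nodes h v) \<le> 4 * Suc (2 * L) ^ 2"
proof -
  have "sum sdd_weight (clump_nodes v) \<le> 2 * (2 * L - 1) * Suc (2 * L)"
    unfolding clump_nodes_def by (rule weight_count_nodes)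
  also have "\<dots> \<le> 2 * Suc (2 * L) ^ 2"
    by (simp only: power2_eq_square mult.assoc) (intro mult_mono, auto)
  moreover have "sum sdd_weight (root_nodes h v) \<le> (Suc (2 * L) * 2) * Suc (2 * L)"
    unfolding root_nodes_def by (rule sum_image_le_card) (auto simp: weight_tree_sdd)
  moreover have "sum sdd_weight (clump_nodes v \<union> root_nodes h v)
      \<le> sum sdd_weight (clump_nodes v) + sum sdd_weight (root_nodes h v)"
    by (rule sum_union_le) (auto simp: clump_nodes_def root_nodes_def)
  ultimately show ?thesis by (simp add: power2_eq_square)
qed

text \<open>The guards, indexed by two counts and a polarity with two elements each, give 4 times
  the square; the two kinds of conjunctions give 8 times a linear term, rounded up to the
  square.\<close>

lemma weight_branch: "sum sdd_weight (branch_nodes h v) \<le> 12 * Suc (2 * L) ^ 2"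
proof -
  let ?A = "(\<lambda>((a, b), p). imp_sdd (sel v) (a + b \<le> L) (tree_conj h v b) p) ` (({..2 * L} \<times> {..2 * L}) \<times> UNIV)"
  let ?B = "(\<lambda>(b, p). tree_conj h v b p) ` ({..2 * L} \<times> (UNIV :: bool set))"
  let ?C = "(\<lambda>(b, p). tree_rest h v b p) ` ({..2 * L} \<times> (UNIV :: bool set))"
  have "sum sdd_weight ?A \<le> (Suc (2 * L) * Suc (2 * L) * 2) * 2"
    by (rule sum_image_le_card) (auto simp: imp_sdd_def)
  moreover have "sum sdd_weight ?B \<le> (Suc (2 * L) * 2) * 2"
    by (rule sum_image_le_card) (auto simp: tree_conj_def and_sdd_def)
  moreover have "sum sdd_weight ?C \<le> (Suc (2 * L) * 2) * 2"
    by (rule sum_image_le_card) (auto simp: tree_rest_def and_sdd_def)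
  moreover have "sum sdd_weight (branch_nodes h v) \<le> sum sdd_weight ?A + sum sdd_weight (?B \<union> ?C)"
    unfolding branch_nodes_def by (rule sum_union_le) auto
  moreover have "sum sdd_weight (?B \<union> ?C) \<le> sum sdd_weight ?B + sum sdd_weight ?C"
    by (rule sum_union_le) auto
  moreover have "8 * Suc (2 * L) \<le> 8 * Suc (2 * L) ^ 2"
    by (simp add: power2_eq_square)
  ultimately show ?thesis unfolding power2_eq_square by linarith
qed

text \<open>Each tree node pays 4 + 12 = 16 squares.\<close>

lemma weight_tree: "sum sdd_weight (tree_nodes h v) \<le> 16 * Suc (2 * L) ^ 2 * tree_size h"
proof (induction h arbitrary: v)
  case 0
  then show ?case using weight_clump_root[of v 0] by simp
next
  case (Suc h)
  let ?w = "sum sdd_weight" and ?T = "\<lambda>i. tree_nodes h (child h v i)"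
  have fin: "finite (branch_nodes h v)" "finite (clump_nodes v \<union> root_nodes (Suc h) v)"
    using finite_tree_nodes[of "Suc h" v] by auto
  have "?w (tree_nodes (Suc h) v) \<le> ?w (clump_nodes v \<union> root_nodes (Suc h) v) +
      ?w (branch_nodes h v \<union> (?T 0 \<union> (?T 1 \<union> ?T 2)))"
    unfolding tree_nodes.simps by (intro sum_union_le) (use fin finite_tree_nodes in auto)
  also have "?w (branch_nodes h v \<union> (?T 0 \<union> (?T 1 \<union> ?T 2))) \<le>
      ?w (branch_nodes h v) + ?w (?T 0 \<union> (?T 1 \<union> ?T 2))"
    by (intro sum_union_le) (use fin finite_tree_nodes in auto)
  also have "?w (?T 0 \<union> (?T 1 \<union> ?T 2)) \<le> ?w (?T 0) + ?w (?T 1 \<union> ?T 2)"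
    by (intro sum_union_le) (use finite_tree_nodes in auto)
  also have "?w (?T 1 \<union> ?T 2) \<le> ?w (?T 1) + ?w (?T 2)"
    by (intro sum_union_le) (use finite_tree_nodes in auto)
  finally show ?case
    using weight_clump_root[of v "Suc h"] weight_branch[of h v]
      Suc.IH[of "child h v 0"] Suc.IH[of "child h v 1"] Suc.IH[of "child h v 2"]
    by simp
qed

lemma sdd_size_tree: "a \<le> 2 * L \<Longrightarrow> sdd_size (tree_sdd h v a p) \<le> 16 * Suc (2 * L) ^ 2 * tree_size h"
  unfolding sdd_size_dnodes
  by (rule order.trans[OF sum_mono2[OF finite_tree_nodes dnodes_tree_sdd] weight_tree]) auto

end

section \<open>Fooling sets for c-NSOBDDs\<close>

lemma path_labels_Nil [simp]: "path_labels [] = []"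
  by (simp add: path_labels_def)

lemma path_labels_append [simp]: "path_labels (P @ Q) = path_labels P @ path_labels Q"
  by (simp add: path_labels_def)

lemma path_labels_Cons: "path_labels (e # Q) =
    (case fst (snd e) of None \<Rightarrow> path_labels Q | Some l \<Rightarrow> l # path_labels Q)"
  by (auto simp: path_labels_def split: option.splits)

lemma is_path_append: "is_path B u (P @ Q) w \<longleftrightarrow> (\<exists>v. is_path B u P v \<and> is_path B v Q w)"
  by (induction P arbitrary: u) auto

lemma is_path_nodes:
  "nbp_wf B \<Longrightarrow> is_path B u P v \<Longrightarrow> u \<in> nodes B \<Longrightarrow> v \<in> nodes B"
  by (induction P arbitrary: u) (auto simp: nbp_wf_def)

text \<open>\<open>A\<close> is an initial segment of the order, so in an ordered piece no label
  inside \<open>A\<close> can follow a label outside it: one cut per piece suffices.\<close>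

lemma ordered_split:
  assumes "ordered_by SV Q"
    and down: "\<And>i j. i < j \<Longrightarrow> j < length SV \<Longrightarrow> SV ! j \<in> A \<Longrightarrow> SV ! i \<in> A"
  shows "\<exists>Q1 Q2. Q = Q1 @ Q2 \<and> fst ` set (path_labels Q1) \<subseteq> A \<and> fst ` set (path_labels Q2) \<inter> A = {}"
  using assms(1)
proof (induction Q)
  case (Cons e Q)
  have "ordered_by SV Q"
    using Cons.prems by (auto simp: ordered_by_def path_labels_Cons split: option.splits)
  then obtain Q1 Q2 where Q: "Q = Q1 @ Q2" "fst ` set (path_labels Q1) \<subseteq> A"
    "fst ` set (path_labels Q2) \<inter> A = {}"
    using Cons.IH by blast
  show ?case
  proof (cases "fst ` set (path_labels [e]) \<subseteq> A")
    \<comment> \<open>This case includes unlabelled edges, which may stay on the \<open>A\<close>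
      side.\<close>
    case True
    have "path_labels (e # Q1) = path_labels [e] @ path_labels Q1"
      by (simp add: path_labels_Cons split: option.splits)
    with True Q show ?thesis
      by (intro exI[of _ "e # Q1"] exI[of _ Q2]) auto
  next
    case False
    then obtain x b where e: "fst (snd e) = Some (x, b)" "x \<notin> A"
      by (auto simp: path_labels_Cons split: option.splits)
    have "fst l \<notin> A" if l: "l \<in> set (path_labels Q)" for l
    proof
      assume "fst l \<in> A"
      moreover obtain i j where "i < j" "j < length SV" "SV ! i = x" "SV ! j = fst l"
        using Cons.prems e l by (auto simp: ordered_by_def path_labels_Cons)
      ultimately show False using down[of i j] e(2) by simp
    qed
    with e show ?thesis
      by (intro exI[of _ "[]"] exI[of _ "e # Q"]) (auto simp: path_labels_Cons)
  qed
qed simp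

lemma subset_graph_iff:
  "R \<subseteq> {(x, \<sigma> x) |x. x \<in> S} \<longleftrightarrow> (\<forall>x b. (x, b) \<in> R \<longrightarrow> x \<in> S \<and> b = \<sigma> x)"
  by auto

definition segment :: "nbp \<Rightarrow> nat set \<Rightarrow> (nat \<Rightarrow> bool) \<Rightarrow> nat \<Rightarrow> nat \<Rightarrow> bool" where
  "segment B S \<sigma> u v \<longleftrightarrow>
     (\<exists>Q. is_path B u Q v \<and> set (path_labels Q) \<subseteq> {(x, \<sigma> x) |x. x \<in> S})"

text \<open>The list records the end nodes of successive segments, the last of which must be the
  leaf; \<open>b\<close> tells whether the next segment reads inside \<open>A\<close>. Segments may
  be empty.\<close>

primrec alternating :: "nbp \<Rightarrow> nat set \<Rightarrow> nat set \<Rightarrow> (nat \<Rightarrow> bool) \<Rightarrow> bool \<Rightarrow> nat \<Rightarrow> nat list \<Rightarrow> bool" where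
  "alternating B X A \<sigma> b u [] \<longleftrightarrow> u = leaf B"
| "alternating B X A \<sigma> b u (v # us) \<longleftrightarrow>
     segment B (if b then X \<inter> A else X - A) \<sigma> u v \<and> alternating B X A \<sigma> (\<not> b) v us"

lemma segment_cong:
  assumes "\<And>x. x \<in> S \<Longrightarrow> \<sigma> x = \<tau> x"
  shows "segment B S \<sigma> u v = segment B S \<tau> u v"
proof -
  have "{(x, \<sigma> x) |x. x \<in> S} = {(x, \<tau> x) |x. x \<in> S}" using assms by force
  then show ?thesis by (simp add: segment_def)
qed

text \<open>This is the exchange step: each segment reads one side of the cut only, so it can be
  taken from the assignment that \<open>\<rho>\<close> copies on that side.\<close>

lemma alternating_mix:
  assumes "alternating B X A \<sigma> b u us" "alternating B X A \<tau> b u us"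
    and "\<And>x. x \<in> A \<Longrightarrow> \<rho> x = \<sigma> x" "\<And>x. x \<notin> A \<Longrightarrow> \<rho> x = \<tau> x"
  shows "alternating B X A \<rho> b u us"
  using assms(1,2)
proof (induction us arbitrary: b u)
  case (Cons v us)
  have "segment B (X \<inter> A) \<rho> u v = segment B (X \<inter> A) \<sigma> u v" "segment B (X - A) \<rho> u v = segment B (X - A) \<tau> u v"
    using assms(3,4) by (auto intro!: segment_cong)
  with Cons show ?case by (auto split: if_splits)
qed simp

lemma alternating_path:
  "alternating B X A \<sigma> b u us \<Longrightarrow>
     \<exists>P. is_path B u P (leaf B) \<and> set (path_labels P) \<subseteq> {(x, \<sigma> x) |x. x \<in> X}"
proof (induction us arbitrary: b u)
  case Nil
  then show ?case by (intro exI[of _ "[]"]) simp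
next
  case (Cons v us)
  obtain Q where Q: "is_path B u Q v" "set (path_labels Q) \<subseteq> {(x, \<sigma> x) |x. x \<in> X}"
    using Cons.prems by (fastforce simp: segment_def split: if_splits)
  obtain P where P: "is_path B v P (leaf B)" "set (path_labels P) \<subseteq> {(x, \<sigma> x) |x. x \<in> X}"
    using Cons.IH[of "\<not> b" v] Cons.prems by auto
  show ?case
    using P Q by (intro exI[of _ "Q @ P"]) (auto simp: is_path_append)
qed

text \<open>Every ordered piece contributes one segment inside and one outside \<open>A\<close>,
  possibly empty. This padding makes all node lists equally long, so that the lists of two
  assignments can coincide entry by entry.\<close>

lemma alternating_exists:
  assumes wf: "nbp_wf B"
    and down: "\<And>i j. i < j \<Longrightarrow> j < length SV \<Longrightarrow> SV ! j \<in> A \<Longrightarrow> SV ! i \<in> A"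
  shows "is_path B u (concat Ps) (leaf B) \<Longrightarrow> \<forall>Q\<in>set Ps. ordered_by SV Q \<Longrightarrow>
     set (path_labels (concat Ps)) \<subseteq> {(x, \<sigma> x) |x. x \<in> X} \<Longrightarrow> u \<in> nodes B \<Longrightarrow>
     \<exists>us. length us = 2 * length Ps \<and> set us \<subseteq> nodes B \<and> alternating B X A \<sigma> True u us"
proof (induction Ps arbitrary: u)
  case (Cons Q Ps)
  obtain Q1 Q2 where Q: "Q = Q1 @ Q2" "fst ` set (path_labels Q1) \<subseteq> A" "fst ` set (path_labels Q2) \<inter> A = {}"
    using ordered_split[of SV Q A] down Cons.prems(2) by auto
  obtain v w where vw: "is_path B u Q1 v" "is_path B v Q2 w" "is_path B w (concat Ps) (leaf B)"
    using Cons.prems(1) Q(1) by (auto simp: is_path_append)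
  have vn: "v \<in> nodes B" "w \<in> nodes B"
    using is_path_nodes[OF wf] vw Cons.prems(4) by blast+
  obtain us where us: "length us = 2 * length Ps" "set us \<subseteq> nodes B" "alternating B X A \<sigma> True w us"
    using Cons.IH[OF vw(3)] Cons.prems vn by auto
  have lab: "x \<in> X" "b = \<sigma> x" if "(x, b) \<in> set (path_labels Q1) \<or> (x, b) \<in> set (path_labels Q2)" for x b
    using Cons.prems(3) Q(1) that by auto
  have "x \<in> A" if "(x, b) \<in> set (path_labels Q1)" for x b
    using that Q(2) by force
  then have "set (path_labels Q1) \<subseteq> {(x, \<sigma> x) |x. x \<in> X \<inter> A}"
    using lab unfolding subset_graph_iff by blast
  moreover have "x \<notin> A" if "(x, b) \<in> set (path_labels Q2)" for x b
    using that Q(3) by force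
  then have "set (path_labels Q2) \<subseteq> {(x, \<sigma> x) |x. x \<in> X - A}"
    using lab unfolding subset_graph_iff by blast
  ultimately have "segment B (X \<inter> A) \<sigma> u v" "segment B (X - A) \<sigma> v w"
    using vw by (auto simp: segment_def)
  with us vn show ?case
    by (intro exI[of _ "v # w # us"]) simp
qed simp

text \<open>Cut every accepting path where it switches between A and its complement. Assignments in
  the fooling set whose paths share all 2c cut nodes could have their pieces exchanged.\<close>

lemma fooling_set_bound:
  assumes wf: "nbp_wf B" and comp: "nbp_computes B X F"
    and ord: "\<And>P. comp_path B P \<Longrightarrow> \<exists>Ps. length Ps = c \<and> concat Ps = P \<and> (\<forall>Q\<in>set Ps. ordered_by SV Q)"
    and down: "\<And>i j. i < j \<Longrightarrow> j < length SV \<Longrightarrow> SV ! j \<in> A \<Longrightarrow> SV ! i \<in> A"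
    and mix: "\<And>k k' x. k \<in> K \<Longrightarrow> k' \<in> K \<Longrightarrow> \<psi> k k' x = (if x \<in> A then \<psi> k k x else \<psi> k' k' x)"
    and sat: "\<And>k. k \<in> K \<Longrightarrow> F (\<psi> k k)"
    and fool: "\<And>k k'. k \<in> K \<Longrightarrow> k' \<in> K \<Longrightarrow> F (\<psi> k k') \<Longrightarrow> F (\<psi> k' k) \<Longrightarrow> k = k'"
  shows "card K \<le> card (nodes B) ^ (2 * c)"
proof -
  have root: "root B \<in> nodes B"
    using wf by (auto simp: nbp_wf_def)
  have "\<exists>us. length us = 2 * c \<and> set us \<subseteq> nodes B \<and> alternating B X A (\<psi> k k) True (root B) us"
    if k: "k \<in> K" for k
  proof -
    obtain P where P: "comp_path B P" "set (path_labels P) \<subseteq> {(x, \<psi> k k x) |x. x \<in> X}"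
      using comp sat[OF k] by (auto simp: nbp_computes_def)
    obtain Ps where Ps: "length Ps = c" "concat Ps = P" "\<forall>Q\<in>set Ps. ordered_by SV Q"
      using ord[OF P(1)] by blast
    show ?thesis
      using alternating_exists[OF wf, of SV A "root B" Ps "\<psi> k k" X] down P Ps root
      by (simp add: comp_path_def)
  qed
  then obtain us where us: "\<And>k. k \<in> K \<Longrightarrow> length (us k) = 2 * c \<and> set (us k) \<subseteq> nodes B \<and>
      alternating B X A (\<psi> k k) True (root B) (us k)"
    by metis
  have accept: "F \<rho>" if alt: "alternating B X A \<rho> True (root B) vs" for \<rho> vs
  proof -
    obtain P where P: "is_path B (root B) P (leaf B)" "set (path_labels P) \<subseteq> {(x, \<rho> x) |x. x \<in> X}"
      using alternating_path[OF alt] by blast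
    \<comment> \<open>Labels that agree with a single assignment cannot be opposite, so the
      recombined path is consistent.\<close>
    have "comp_path B P" using P by (auto simp: comp_path_def consistent_def)
    with P(2) have "\<exists>P. comp_path B P \<and> set (path_labels P) \<subseteq> {(x, \<rho> x) |x. x \<in> X}"
      by (intro exI[of _ P] conjI)
    then show ?thesis using comp by (simp add: nbp_computes_def)
  qed
  have "inj_on us K"
  proof (rule inj_onI)
    fix k k' assume k: "k \<in> K" "k' \<in> K" "us k = us k'"
    have "F (\<psi> i j)" if "i \<in> K" "j \<in> K" "us i = us j" for i j
    proof (rule accept, rule alternating_mix)
      show "alternating B X A (\<psi> i i) True (root B) (us i)" "alternating B X A (\<psi> j j) True (root B) (us i)"
        using that us[of i] us[of j] by simp_all
      show "x \<in> A \<Longrightarrow> \<psi> i j x = \<psi> i i x" "x \<notin> A \<Longrightarrow> \<psi> i j x = \<psi> j j x" for x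
        using mix[OF that(1,2), of x] by simp_all
    qed
    then show "k = k'" using fool k by metis
  qed
  moreover have "us ` K \<subseteq> {xs. set xs \<subseteq> nodes B \<and> length xs = 2 * c}"
    using us by auto
  moreover have fin: "finite (nodes B)" using wf by (simp add: nbp_wf_def)
  ultimately have "card K \<le> card {xs. set xs \<subseteq> nodes B \<and> length xs = 2 * c}"
    by (intro card_inj_on_le[of us]) (auto intro: finite_lists_length_eq)
  then show ?thesis using fin by (simp add: card_lists_length_eq)
qed

section \<open>Crossing matchings in ternary trees\<close>

lemma tree_size_pos: "0 < tree_size h"
  by (cases h) simp_all

lemma child_bounds:
  assumes "i < 3"
  shows "v < child h v i" "child h v i + tree_size h \<le> v + tree_size (Suc h)"
proof -
  have "i * tree_size h \<le> 2 * tree_size h" using assms by (intro mult_le_mono1) simp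
  then show "v < child h v i" "child h v i + tree_size h \<le> v + tree_size (Suc h)"
    by (simp_all add: child_def)
qed

lemma child_disjoint:
  assumes "i \<noteq> j"
  shows "{child h v i..<child h v i + tree_size h} \<inter> {child h v j..<child h v j + tree_size h} = {}"
proof -
  have "child h v i + tree_size h \<le> child h v j" if "i < j" for i j
    using mult_le_mono1[of "Suc i" j "tree_size h"] that by (simp add: child_def)
  from this[of i j] this[of j i] assms show ?thesis by (cases i j rule: linorder_cases) auto
qed

lemma tree_edges_bounds:
  "(u, w) \<in> tree_edges h v \<Longrightarrow> v \<le> u \<and> u < w \<and> w < v + tree_size h"
proof (induction h arbitrary: v)
  case (Suc h)
  then obtain i where i: "i < 3" "(u, w) = (v, child h v i) \<or> (u, w) \<in> tree_edges h (child h v i)"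
    by auto
  show ?case
    using i(2) Suc.IH[of "child h v i"] child_bounds[OF i(1), where v = v and h = h] tree_size_pos[of h]
    by (elim disjE) (simp, force)
qed simp

text \<open>An edge is determined by its lower end, so a selector kept there controls one edge
  only.\<close>

lemma tree_parent_unique:
  "(u, w) \<in> tree_edges h v \<Longrightarrow> (u', w) \<in> tree_edges h v \<Longrightarrow> u = u'"
proof (induction h arbitrary: v)
  case (Suc h)
  obtain i where i: "i < 3" "(u, w) = (v, child h v i) \<or> (u, w) \<in> tree_edges h (child h v i)"
    using Suc.prems(1) by auto
  obtain j where j: "j < 3" "(u', w) = (v, child h v j) \<or> (u', w) \<in> tree_edges h (child h v j)"
    using Suc.prems(2) by auto
  have "w \<in> {child h v i..<child h v i + tree_size h}" "w \<in> {child h v j..<child h v j + tree_size h}"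
    using i(2) j(2) tree_edges_bounds[of u w h "child h v i"] tree_edges_bounds[of u' w h "child h v j"]
      tree_size_pos[of h] by auto
  then have "i = j" using child_disjoint[of i j h v] by blast
  then show ?case
    using i(2) j(2) Suc.IH tree_edges_bounds[of u w h "child h v i"]
      tree_edges_bounds[of u' w h "child h v i"] by auto
qed simp

text \<open>Connectedness without paths: if both values of \<open>P\<close> occur in the tree, some
  edge must join them.\<close>

lemma tree_connected:
  "(\<And>u w. (u, w) \<in> tree_edges h v \<Longrightarrow> P u = P w) \<Longrightarrow> v \<le> x \<Longrightarrow> x < v + tree_size h \<Longrightarrow>
     (P x :: bool) = P v"
proof (induction h arbitrary: v)
  case (Suc h)
  show ?case
  proof (cases "x = v")
    case False
    have "\<exists>i<3. child h v i \<le> x \<and> x < child h v i + tree_size h"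
    proof -
      consider "x < child h v 1" | "child h v 1 \<le> x" "x < child h v 2" | "child h v 2 \<le> x"
        by linarith
      then show ?thesis
        using Suc.prems(2,3) False
        by cases (intro exI[of _ 0] exI[of _ 1] exI[of _ 2], simp add: child_def)+
    qed
    then obtain i where i: "i < 3" "child h v i \<le> x" "x < child h v i + tree_size h" by blast
    have "P x = P (child h v i)"
      by (rule Suc.IH[OF _ i(2,3)]) (use Suc.prems(1) i(1) in auto)
    also have "\<dots> = P v"
      using Suc.prems(1)[of v "child h v i"] i(1) by auto
    finally show ?thesis .
  qed simp
qed (simp add: le_less_Suc_eq)

definition disjoint_pairs :: "('a \<times> 'a) set \<Rightarrow> bool" where
  "disjoint_pairs E \<longleftrightarrow> (\<forall>e\<in>E. \<forall>e'\<in>E. e \<noteq> e' \<longrightarrow> {fst e, snd e} \<inter> {fst e', snd e'} = {})"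

lemma disjoint_pairs_insert:
  assumes "disjoint_pairs E" "\<And>e. e \<in> E \<Longrightarrow> {fst e, snd e} \<inter> {u, w} = {}"
  shows "disjoint_pairs (insert (u, w) E)"
  unfolding disjoint_pairs_def
proof (intro ballI impI)
  fix e e' assume e: "e \<in> insert (u, w) E" "e' \<in> insert (u, w) E" "e \<noteq> e'"
  then consider "e = (u, w)" "e' \<in> E" | "e' = (u, w)" "e \<in> E" | "e \<in> E" "e' \<in> E" by blast
  then show "{fst e, snd e} \<inter> {fst e', snd e'} = {}"
  proof cases
    case 1
    then show ?thesis using assms(2)[of e'] by (simp only: fst_conv snd_conv) blast
  next
    case 2
    then show ?thesis using assms(2)[of e] by simp
  next
    case 3
    then show ?thesis using assms(1) e(3) by (simp add: disjoint_pairs_def)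
  qed
qed

lemma sort_three:
  fixes t :: "nat \<Rightarrow> nat"
  obtains i j k where "i < 3" "j < 3" "k < 3" "i \<noteq> j" "j \<noteq> k" "i \<noteq> k" "t i \<le> t j" "t j \<le> t k"
proof -
  consider "t 0 \<le> t 1" "t 1 \<le> t 2" | "t 0 \<le> t 2" "t 2 \<le> t 1" | "t 1 \<le> t 0" "t 0 \<le> t 2"
    | "t 1 \<le> t 2" "t 2 \<le> t 0" | "t 2 \<le> t 0" "t 0 \<le> t 1" | "t 2 \<le> t 1" "t 1 \<le> t 0"
    by linarith
  then show ?thesis
  proof cases
    case 1
    show ?thesis by (rule that[of 0 1 2]) (fact | simp)+
  next
    case 2
    show ?thesis by (rule that[of 0 2 1]) (fact | simp)+
  next
    case 3
    show ?thesis by (rule that[of 1 0 2]) (fact | simp)+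
  next
    case 4
    show ?thesis by (rule that[of 1 2 0]) (fact | simp)+
  next
    case 5
    show ?thesis by (rule that[of 2 0 1]) (fact | simp)+
  next
    case 6
    show ?thesis by (rule that[of 2 1 0]) (fact | simp)+
  qed
qed

declare tree_edges.simps(2) [simp del] tree_size.simps(2) [simp del]

text \<open>Order the three subtrees by the times at which they have a large crossing matching. At the
  middle time the first subtree already contains a marked node and the last one still an unmarked
  node, so the path joining them avoids the middle subtree and contributes one more crossing edge.\<close>

lemma crossing_matching:
  fixes \<tau> :: "nat \<Rightarrow> nat"
  assumes "inj_on \<tau> {v..<v + tree_size (Suc h)}"
  shows "\<exists>t E. E \<subseteq> tree_edges (Suc h) v \<and> finite E \<and> card E = Suc h \<and> disjoint_pairs E \<and>
     (\<forall>(u, w)\<in>E. (\<tau> u \<le> t) \<noteq> (\<tau> w \<le> t))"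
  using assms
proof (induction h arbitrary: v)
  case 0
  let ?w = "child 0 v 0"
  have "\<tau> v \<noteq> \<tau> ?w"
    using inj_onD[OF 0, of v ?w] by (auto simp: child_def tree_size.simps(2))
  \<comment> \<open>The times of the two ends differ, so the smaller one separates them.\<close>
  then show ?case
    by (intro exI[of _ "min (\<tau> v) (\<tau> ?w)"] exI[of _ "{(v, ?w)}"]) (auto simp: disjoint_pairs_def tree_edges.simps(2))
next
  case (Suc h)
  define c where "c = child (Suc h) v"
  let ?T = "\<lambda>i. {c i..<c i + tree_size (Suc h)}"
  have sub: "?T i \<subseteq> {v<..<v + tree_size (Suc (Suc h))}" if "i < 3" for i
    using child_bounds[OF that, where v = v and h = "Suc h"] unfolding c_def by auto
  define good where "good i t E \<longleftrightarrow> E \<subseteq> tree_edges (Suc h) (c i) \<and> finite E \<and> card E = Suc h \<and>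
     disjoint_pairs E \<and> (\<forall>(u, w)\<in>E. (\<tau> u \<le> t) \<noteq> (\<tau> w \<le> t))" for i t E
  have "\<exists>t E. good i t E" if "i < 3" for i
    unfolding good_def
    by (rule Suc.IH, rule inj_on_subset[OF Suc.prems], rule order.trans[OF sub[OF that]]) auto
  then have "\<forall>i. \<exists>p. i < 3 \<longrightarrow> good i (fst p) (snd p)"
    by auto
  from choice[OF this] obtain p where "\<forall>i. i < 3 \<longrightarrow> good i (fst (p i)) (snd (p i))" ..
  then obtain t E where "\<And>i. i < 3 \<Longrightarrow> good i (t i) (E i)"
    using that[of "\<lambda>i. fst (p i)" "\<lambda>i. snd (p i)"] by simp
  note tE = this[unfolded good_def]
  have edge: "e \<in> tree_edges (Suc h) (c m)" "{fst e, snd e} \<subseteq> ?T m"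
    "(\<tau> (fst e) \<le> t m) \<noteq> (\<tau> (snd e) \<le> t m)" if "e \<in> E m" "m < 3" for e m
  proof -
    show 1: "e \<in> tree_edges (Suc h) (c m)" using that tE[of m] by blast
    then show "{fst e, snd e} \<subseteq> ?T m"
      using tree_edges_bounds[of "fst e" "snd e" "Suc h" "c m"] by auto
    show "(\<tau> (fst e) \<le> t m) \<noteq> (\<tau> (snd e) \<le> t m)"
      using tE[OF that(2)] that(1) by (auto simp: case_prod_beta)
  qed
  obtain i j k where ijk: "i < 3" "j < 3" "k < 3" "i \<noteq> j" "j \<noteq> k" "i \<noteq> k" "t i \<le> t j" "t j \<le> t k"
    by (rule sort_three)
  \<comment> \<open>The matching of each subtree is nonempty, and any of its edges supplies a node
    on either side of the threshold.\<close>
  have ends: "(\<exists>x\<in>?T m. \<tau> x \<le> t m) \<and> (\<exists>y\<in>?T m. \<not> \<tau> y \<le> t m)" if m: "m < 3" for m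
  proof -
    have "E m \<noteq> {}" using tE[OF m] by auto
    then obtain u w where uw: "(u, w) \<in> E m" by auto
    show ?thesis using edge(2,3)[OF uw m] by auto
  qed
  \<comment> \<open>The edges joining the first and the last subtree through v; none of them touches
    the middle subtree.\<close>
  define S where "S = {(v, c i), (v, c k)} \<union> tree_edges (Suc h) (c i) \<union> tree_edges (Suc h) (c k)"
  have "\<exists>(u, w)\<in>S. (\<tau> u \<le> t j) \<noteq> (\<tau> w \<le> t j)"
  proof (rule ccontr)
    assume "\<not> (\<exists>(u, w)\<in>S. (\<tau> u \<le> t j) \<noteq> (\<tau> w \<le> t j))"
    then have no: "(\<tau> u \<le> t j) = (\<tau> w \<le> t j)" if "(u, w) \<in> S" for u w
      using that by blast
    have conn: "(\<tau> x \<le> t j) = (\<tau> v \<le> t j)" if "x \<in> ?T m" "m = i \<or> m = k" for x m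
    proof -
      have "(\<tau> x \<le> t j) = (\<tau> (c m) \<le> t j)"
        by (rule tree_connected[of "Suc h" "c m" "\<lambda>x. \<tau> x \<le> t j"]) (use that no in \<open>auto simp: S_def\<close>)
      also have "\<dots> = (\<tau> v \<le> t j)"
        using no[of v "c m"] that(2) by (auto simp: S_def)
      finally show ?thesis .
    qed
    obtain x where "x \<in> ?T i" "\<tau> x \<le> t i" using ends[OF ijk(1)] by blast
    moreover obtain y where "y \<in> ?T k" "\<not> \<tau> y \<le> t k" using ends[OF ijk(3)] by blast
    ultimately show False
      using conn[of x i] conn[of y k] ijk(7,8) by linarith
  qed
  then obtain u w where uw: "(u, w) \<in> S" "(\<tau> u \<le> t j) \<noteq> (\<tau> w \<le> t j)" by blast
  have "{u, w} \<subseteq> insert v (?T i \<union> ?T k)"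
    using uw(1) tree_edges_bounds[of u w "Suc h" "c i"] tree_edges_bounds[of u w "Suc h" "c k"]
      tree_size_pos[of "Suc h"] by (auto simp: S_def)
  moreover have "?T i \<inter> ?T j = {}" "?T k \<inter> ?T j = {}" "v \<notin> ?T j"
    using child_disjoint[of i j "Suc h" v] child_disjoint[of k j "Suc h" v] ijk sub[OF ijk(2)]
    unfolding c_def by auto
  ultimately have out: "{u, w} \<inter> ?T j = {}" by blast
  have inside: "{fst e, snd e} \<subseteq> ?T j" if "e \<in> E j" for e
    using edge(2) that ijk(2) .
  have new: "(u, w) \<notin> E j" using out inside[of "(u, w)"] by auto
  have "S \<subseteq> tree_edges (Suc (Suc h)) v" "E j \<subseteq> tree_edges (Suc (Suc h)) v"
    using ijk edge(1)[OF _ ijk(2)] unfolding S_def c_def tree_edges.simps(2)[of "Suc h"] by blast+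
  then have "insert (u, w) (E j) \<subseteq> tree_edges (Suc (Suc h)) v" using uw(1) by blast
  moreover have "disjoint_pairs (insert (u, w) (E j))"
  proof (rule disjoint_pairs_insert)
    show "disjoint_pairs (E j)" using tE[OF ijk(2)] by blast
    show "{fst e, snd e} \<inter> {u, w} = {}" if "e \<in> E j" for e
      using out inside[OF that] by blast
  qed
  moreover have "\<forall>(u, w)\<in>insert (u, w) (E j). (\<tau> u \<le> t j) \<noteq> (\<tau> w \<le> t j)"
    using uw(2) edge(3)[OF _ ijk(2)] by (simp add: case_prod_beta)
  ultimately show ?case
    using tE[OF ijk(2)] new by (intro exI[of _ "t j"] exI[of _ "insert (u, w) (E j)"]) simp
qed

section \<open>A fooling set for the tree function\<close>

context
  fixes L :: nat
  assumes L: "0 < L"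
begin

definition clump :: "nat \<Rightarrow> nat set" where
  "clump v = {v * Suc (2 * L)..<v * Suc (2 * L) + 2 * L}"

lemma finite_clump [simp]: "finite (clump v)" and card_clump [simp]: "card (clump v) = 2 * L"
  by (simp_all add: clump_def)

lemma clump_count_eq: "clump_count L v \<sigma> = card {i \<in> clump v. \<sigma> i}"
  by (simp add: clump_count_def[OF L] ones_def clump_def)

text \<open>The quotient by 2L + 1 recovers the owner of a variable, and the remainder 2L is
  reserved for the selector; all disjointness facts follow from this.\<close>

lemma clump_divmod: "i \<in> clump v \<Longrightarrow> i div Suc (2 * L) = v \<and> i mod Suc (2 * L) < 2 * L"
proof -
  assume "i \<in> clump v"
  then obtain j where "i = v * Suc (2 * L) + j" "j < 2 * L"
    by (auto simp: clump_def dest: le_Suc_ex simp del: mult_Suc_right)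
  then show ?thesis by (simp del: mult_Suc_right)
qed

lemma sel_divmod: "sel L v div Suc (2 * L) = v" "sel L v mod Suc (2 * L) = 2 * L"
  by (simp_all add: sel_def[OF L] del: mult_Suc_right)

lemma sel_eq_iff: "sel L v = sel L w \<longleftrightarrow> v = w"
  using sel_divmod(1) by metis

lemma sel_notin_clump: "sel L v \<notin> clump w"
  using clump_divmod sel_divmod(2) by fastforce

lemma clump_unique: "i \<in> clump v \<Longrightarrow> i \<in> clump w \<Longrightarrow> v = w"
  using clump_divmod by metis

text \<open>On each edge of the matching, the two endpoints hold k and L - k ones, drawn from opposite
  sides of the cut; the selectors switch on exactly the matching edges.\<close>

lemma tree_fooling:
  assumes E: "E \<subseteq> tree_edges h 0" "finite E" "disjoint_pairs E"
    and cross: "\<And>u w. (u, w) \<in> E \<Longrightarrow> \<phi> u \<noteq> \<phi> w"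
    and many: "\<And>x. \<phi> x \<Longrightarrow> L \<le> card (clump x \<inter> A)" "\<And>x. \<not> \<phi> x \<Longrightarrow> L \<le> card (clump x - A)"
  shows "\<exists>\<psi>. (\<forall>k k' x. \<psi> k k' x = (if x \<in> A then \<psi> k k x else \<psi> k' k' x)) \<and>
    (\<forall>k\<in>E \<rightarrow>\<^sub>E {..L}. \<forall>k'\<in>E \<rightarrow>\<^sub>E {..L}.
       tree_fun L h 0 0 (\<psi> k k') \<longleftrightarrow> (\<forall>e\<in>E. k e \<le> k' e))"
proof -
  have "\<exists>C. C \<subseteq> clump x \<inter> (if \<phi> x then A else - A) \<and> card C = j" if "j \<le> L" for x j
  proof -
    have "j \<le> card (clump x \<inter> (if \<phi> x then A else - A))"
      using many[of x] that by (auto simp: Diff_eq)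
    from obtain_subset_with_card_n[OF this] show ?thesis by blast
  qed
  then have "\<forall>x j. \<exists>C. j \<le> L \<longrightarrow> C \<subseteq> clump x \<inter> (if \<phi> x then A else - A) \<and> card C = j"
    by blast
  then obtain C where C: "\<And>x j. j \<le> L \<Longrightarrow> C x j \<subseteq> clump x \<inter> (if \<phi> x then A else - A) \<and> card (C x j) = j"
    by metis
  \<comment> \<open>Ends inside \<open>A\<close> obey k and the others obey k', so an edge sums to k
    + L - k'. Since \<open>C\<close> is only specified up to L, the \<open>min\<close> keeps
    \<open>\<psi>\<close> meaningful for arbitrary k; for k bounded by L it changes nothing.\<close>
  define val where "val k k' e x = min L (if \<phi> x then k e else L - k' e)"
    for k k' :: "nat \<times> nat \<Rightarrow> nat" and e x
  have CC: "C x (val k k' e x) \<subseteq> clump x \<inter> (if \<phi> x then A else - A)" "card (C x (val k k' e x)) = val k k' e x"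
    for x k k' e
    using C[of "val k k' e x" x] by (auto simp: val_def)
  define \<psi> where "\<psi> k k' i \<longleftrightarrow> i \<in> sel L ` snd ` E \<or> (\<exists>e\<in>E. \<exists>x\<in>{fst e, snd e}. i \<in> C x (val k k' e x))"
    for k k' i
  have unique: "e = e'" if "e \<in> E" "e' \<in> E" "x \<in> {fst e, snd e}" "x \<in> {fst e', snd e'}" for e e' x
    using E(3) that unfolding disjoint_pairs_def by blast
  have count: "clump_count L x (\<psi> k k') = val k k' e x" if e: "e \<in> E" "x \<in> {fst e, snd e}" for e x k k'
  proof -
    have "i \<in> C x (val k k' e x)" if i: "i \<in> clump x" "\<psi> k k' i" for i
    proof -
      obtain e' y where y: "e' \<in> E" "y \<in> {fst e', snd e'}" "i \<in> C y (val k k' e' y)"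
        using i sel_notin_clump unfolding \<psi>_def by blast
      have "i \<in> clump y" using CC(1)[of y k k' e'] y(3) by blast
      then have "y = x" using i(1) clump_unique by blast
      then show ?thesis using unique[of e e' x] e y by blast
    qed
    moreover have "i \<in> clump x \<and> \<psi> k k' i" if "i \<in> C x (val k k' e x)" for i
      using that e CC(1)[of x k k' e] unfolding \<psi>_def by blast
    ultimately have "{i \<in> clump x. \<psi> k k' i} = C x (val k k' e x)" by blast
    then show ?thesis using CC(2) by (simp add: clump_count_eq)
  qed
  have sel: "\<psi> k k' (sel L w) \<longleftrightarrow> w \<in> snd ` E" for k k' w
  proof -
    have "sel L w \<notin> C x (val k k' e x)" for e x
      using CC(1)[of x k k' e] sel_notin_clump by blast
    then have "\<psi> k k' (sel L w) \<longleftrightarrow> sel L w \<in> sel L ` snd ` E"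
      unfolding \<psi>_def by blast
    also have "\<dots> \<longleftrightarrow> w \<in> snd ` E"
      by (rule inj_image_mem_iff) (simp add: inj_def sel_eq_iff)
    finally show ?thesis .
  qed
  show ?thesis
  proof (intro exI[of _ \<psi>] conjI allI ballI)
    \<comment> \<open>Each chosen set lies on a single side of the cut, and its size depends on the
      one argument responsible for that side; the selectors depend on neither.\<close>
    show "\<psi> k k' x = (if x \<in> A then \<psi> k k x else \<psi> k' k' x)" for k k' x
    proof -
      have "x \<in> C y (val k k' e y) \<longleftrightarrow>
          (if x \<in> A then x \<in> C y (val k k e y) else x \<in> C y (val k' k' e y))" for e y
        using CC(1)[of y k k' e] CC(1)[of y k k e] CC(1)[of y k' k' e]
        by (cases "\<phi> y"; cases "x \<in> A") (auto simp: val_def)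
      then show ?thesis unfolding \<psi>_def by simp
    qed
  next
    fix k k' assume k: "k \<in> E \<rightarrow>\<^sub>E {..L}" "k' \<in> E \<rightarrow>\<^sub>E {..L}"
    \<comment> \<open>The selector of the root is off, so its extra condition is void.\<close>
    have root: "0 \<notin> snd ` E"
      using tree_edges_bounds E(1) by fastforce
    have edge: "clump_count L u (\<psi> k k') + clump_count L w (\<psi> k k') \<le> L \<longleftrightarrow> k (u, w) \<le> k' (u, w)"
      if uw: "(u, w) \<in> E" for u w
    proof -
      have "k (u, w) \<le> L" "k' (u, w) \<le> L" using k uw by (auto simp: PiE_def Pi_def)
      moreover have "clump_count L u (\<psi> k k') = val k k' (u, w) u" "clump_count L w (\<psi> k k') = val k k' (u, w) w"
        by (rule count[OF uw]; simp)+
      ultimately show ?thesis using cross[OF uw] by (cases "\<phi> u") (auto simp: val_def)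
    qed
    have "(u, w) \<in> E" if uw: "(u, w) \<in> tree_edges h 0" "w \<in> snd ` E" for u w
    proof -
      obtain u' where u': "(u', w) \<in> E" using uw(2) by force
      then have "u' = u" using tree_parent_unique uw(1) E(1) by blast
      with u' show ?thesis by simp
    qed
    then have "tree_fun L h 0 0 (\<psi> k k') \<longleftrightarrow>
        (\<forall>(u, w)\<in>E. clump_count L u (\<psi> k k') + clump_count L w (\<psi> k k') \<le> L)"
      unfolding tree_fun_def[OF L] sel using root E(1) by force
    also have "\<dots> \<longleftrightarrow> (\<forall>e\<in>E. k e \<le> k' e)"
      using edge by auto
    finally show "tree_fun L h 0 0 (\<psi> k k') \<longleftrightarrow> (\<forall>e\<in>E. k e \<le> k' e)" .
  qed
qed

section \<open>Cutting an arbitrary variable order\<close>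

text \<open>The order of a program lists only the variables that it reads. The others are placed
  behind them, so that every variable of every clump has a position of its own.\<close>

lemma injective_positions:
  fixes xs :: "nat list"
  assumes "distinct xs"
  obtains pos :: "nat \<Rightarrow> nat" where "inj pos" "\<And>i. i < length xs \<Longrightarrow> pos (xs ! i) = i"
proof -
  define pos where "pos x = (if x \<in> set xs then the_inv_into {..<length xs} ((!) xs) x else length xs + x)" for x
  have bij: "bij_betw ((!) xs) {..<length xs} (set xs)"
    using assms by (simp add: bij_betw_nth)
  have nth: "pos (xs ! i) = i" if "i < length xs" for i
    using that bij by (simp add: pos_def bij_betw_def the_inv_into_f_f)
  have "inj pos"
  proof (rule injI)
    fix x y assume eq: "pos x = pos y"
    have lt: "pos z < length xs \<and> xs ! pos z = z" if "z \<in> set xs" for z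
      using that nth by (auto simp: in_set_conv_nth)
    show "x = y"
      using eq lt[of x] lt[of y] by (cases "x \<in> set xs"; cases "y \<in> set xs") (auto simp: pos_def)
  qed
  with nth show thesis using that by blast
qed

text \<open>The earliest cut with at least half of the clump before it.\<close>

definition half_time :: "(nat \<Rightarrow> nat) \<Rightarrow> nat \<Rightarrow> nat" where
  "half_time pos v = (LEAST t. L \<le> card {i \<in> clump v. pos i < t})"

lemma half_time_exists:
  fixes pos :: "nat \<Rightarrow> nat"
  shows "\<exists>t. L \<le> card {i \<in> clump v. pos i < t}"
proof -
  have "{i \<in> clump v. pos i < Suc (Max (pos ` clump v))} = clump v"
    by (auto simp: less_Suc_eq_le)
  then have "card {i \<in> clump v. pos i < Suc (Max (pos ` clump v))} = 2 * L" by simp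
  then show ?thesis by (intro exI[of _ "Suc (Max (pos ` clump v))"]) simp
qed

lemma half_time_le_iff: "half_time pos v \<le> t \<longleftrightarrow> L \<le> card {i \<in> clump v. pos i < t}"
proof
  have "L \<le> card {i \<in> clump v. pos i < half_time pos v}"
    unfolding half_time_def using half_time_exists by (rule LeastI_ex)
  also assume "half_time pos v \<le> t"
  then have "card {i \<in> clump v. pos i < half_time pos v} \<le> card {i \<in> clump v. pos i < t}"
    by (intro card_mono) auto
  finally show "L \<le> card {i \<in> clump v. pos i < t}" .
next
  assume "L \<le> card {i \<in> clump v. pos i < t}"
  then show "half_time pos v \<le> t" unfolding half_time_def by (rule Least_le)
qed

text \<open>The count rises only where a variable of the clump is passed; otherwise the cut could be
  moved back by one, against minimality. Time 0 is excluded because L is positive.\<close>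

lemma half_time_attained: "\<exists>i\<in>clump v. Suc (pos i) = half_time pos v"
proof (rule ccontr)
  assume none: "\<not> (\<exists>i\<in>clump v. Suc (pos i) = half_time pos v)"
  have eq: "{i \<in> clump v. pos i < half_time pos v} = {i \<in> clump v. pos i < half_time pos v - 1}"
  proof (rule Collect_cong, rule conj_cong[OF refl])
    fix i assume "i \<in> clump v"
    then have "Suc (pos i) \<noteq> half_time pos v" using none by blast
    then show "pos i < half_time pos v \<longleftrightarrow> pos i < half_time pos v - 1" by linarith
  qed
  have "L \<le> card {i \<in> clump v. pos i < half_time pos v}"
    using half_time_le_iff[of pos v "half_time pos v"] by simp
  then have "half_time pos v \<le> half_time pos v - 1"
    unfolding eq half_time_le_iff[of pos v "half_time pos v - 1"] .
  then have "half_time pos v = 0" by simp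
  then show False using half_time_le_iff[of pos v 0] L by simp
qed

text \<open>Half times come from positions of variables in disjoint clumps. Their distinctness is
  what lets a threshold separate the two ends of an edge.\<close>

lemma inj_half_time:
  assumes "inj pos"
  shows "inj (half_time pos)"
proof (rule injI)
  fix v w assume eq: "half_time pos v = half_time pos w"
  obtain i where i: "i \<in> clump v" "Suc (pos i) = half_time pos v" using half_time_attained by blast
  obtain j where j: "j \<in> clump w" "Suc (pos j) = half_time pos w" using half_time_attained by blast
  have "pos i = pos j" using i(2) j(2) eq by linarith
  then have "i = j" using assms by (simp add: inj_eq)
  then show "v = w" using clump_unique i(1) j(1) by blast
qed

lemma tree_fun_lower_bound:
  assumes B: "c_nsobdd c B" and comp: "nbp_computes B X (tree_fun L (Suc h) 0 0)"
  shows "Suc L ^ Suc h \<le> nbp_size B ^ (2 * c)"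
proof -
  obtain SV where SV: "distinct SV"
    "\<And>P. comp_path B P \<Longrightarrow> \<exists>Ps. length Ps = c \<and> concat Ps = P \<and> (\<forall>Q\<in>set Ps. ordered_by SV Q)"
    using B unfolding c_nsobdd_def by blast
  obtain pos where pos: "inj pos" "\<And>i. i < length SV \<Longrightarrow> pos (SV ! i) = i"
    using injective_positions[OF SV(1)] by blast
  have "inj_on (half_time pos) {0..<0 + tree_size (Suc h)}"
    using inj_half_time[OF pos(1)] by (rule inj_on_subset) simp
  from crossing_matching[OF this] obtain t E where E: "E \<subseteq> tree_edges (Suc h) 0" "finite E"
    "card E = Suc h" "disjoint_pairs E" "\<forall>(u, w)\<in>E. (half_time pos u \<le> t) \<noteq> (half_time pos w \<le> t)"
    by blast
  define A where "A = {i. pos i < t}"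
  have in_A: "half_time pos x \<le> t \<longleftrightarrow> L \<le> card (clump x \<inter> A)" for x
    by (simp add: half_time_le_iff A_def Collect_conj_eq[symmetric] Int_def)
  \<comment> \<open>Fewer than L of the 2L variables before the cut leave more than L behind
    it.\<close>
  have out_A: "L \<le> card (clump x - A)" if "\<not> half_time pos x \<le> t" for x
  proof -
    have "card (clump x) = card (clump x \<inter> A) + card (clump x - A)"
      using card_Int_Diff[of "clump x" A] by simp
    then show ?thesis using that in_A[of x] by simp
  qed
  have "\<exists>\<psi>. (\<forall>k k' x. \<psi> k k' x = (if x \<in> A then \<psi> k k x else \<psi> k' k' x)) \<and>
    (\<forall>k\<in>E \<rightarrow>\<^sub>E {..L}. \<forall>k'\<in>E \<rightarrow>\<^sub>E {..L}.
       tree_fun L (Suc h) 0 0 (\<psi> k k') \<longleftrightarrow> (\<forall>e\<in>E. k e \<le> k' e))"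
  proof (rule tree_fooling[OF E(1,2,4), of "\<lambda>x. half_time pos x \<le> t" A])
    show "(half_time pos u \<le> t) \<noteq> (half_time pos w \<le> t)" if "(u, w) \<in> E" for u w
      using E(5) that by blast
    show "half_time pos x \<le> t \<Longrightarrow> L \<le> card (clump x \<inter> A)" for x
      using in_A by blast
    show "\<not> half_time pos x \<le> t \<Longrightarrow> L \<le> card (clump x - A)" for x
      by (rule out_A)
  qed
  then obtain \<psi> where mix: "\<forall>k k' x. \<psi> k k' x = (if x \<in> A then \<psi> k k x else \<psi> k' k' x)"
    and eval: "\<forall>k\<in>E \<rightarrow>\<^sub>E {..L}. \<forall>k'\<in>E \<rightarrow>\<^sub>E {..L}.
       tree_fun L (Suc h) 0 0 (\<psi> k k') \<longleftrightarrow> (\<forall>e\<in>E. k e \<le> k' e)"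
    by (elim exE conjE)
  have "card (E \<rightarrow>\<^sub>E {..L}) \<le> card (nodes B) ^ (2 * c)"
  proof (rule fooling_set_bound[OF _ comp SV(2), where A = A and \<psi> = \<psi>])
    show "nbp_wf B" using B by (simp add: c_nsobdd_def)
    show "\<psi> k k' x = (if x \<in> A then \<psi> k k x else \<psi> k' k' x)" for k k' x
      by (rule mix[rule_format])
    show "tree_fun L (Suc h) 0 0 (\<psi> k k)" if "k \<in> E \<rightarrow>\<^sub>E {..L}" for k
      using eval[rule_format, OF that that] by simp
    show "SV ! i \<in> A" if "i < j" "j < length SV" "SV ! j \<in> A" for i j
      using that pos(2) by (simp add: A_def)
    \<comment> \<open>Acceptance of both mixtures gives k <= k' and k' <= k on every matching
      edge.\<close>
    show "k = k'" if k: "k \<in> E \<rightarrow>\<^sub>E {..L}" "k' \<in> E \<rightarrow>\<^sub>E {..L}"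
      "tree_fun L (Suc h) 0 0 (\<psi> k k')" "tree_fun L (Suc h) 0 0 (\<psi> k' k)" for k k'
    proof (rule PiE_ext[OF k(1,2)])
      fix e assume "e \<in> E"
      then show "k e = k' e"
        using k(3,4) eval[rule_format, OF k(1,2)] eval[rule_format, OF k(2,1)] by (simp add: le_antisym)
    qed
  qed
  then show ?thesis
    using E(2,3) by (simp add: card_PiE nbp_size_def)
qed

end

section \<open>The family of functions\<close>

lemma clump_count_cong:
  assumes "0 < L" "\<And>x. x < Suc v * Suc (2 * L) \<Longrightarrow> \<sigma> x = \<tau> x"
  shows "clump_count L v \<sigma> = clump_count L v \<tau>"
  unfolding clump_count_def[OF assms(1)] by (rule ones_cong) (use assms(2) in auto)

lemma depends_tree_fun:
  assumes L: "0 < L"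
  shows "depends_only_on {0..<tree_size h * Suc (2 * L)} (tree_fun L h 0 0)"
  unfolding depends_only_on_def
proof (intro allI impI)
  fix \<sigma> \<tau> :: "nat \<Rightarrow> bool"
  assume eq: "\<forall>x\<in>{0..<tree_size h * Suc (2 * L)}. \<sigma> x = \<tau> x"
  have le: "Suc v * Suc (2 * L) \<le> tree_size h * Suc (2 * L)" if "v < tree_size h" for v
    using that by (intro mult_le_mono1) simp
  have count: "clump_count L v \<sigma> = clump_count L v \<tau>" if "v < tree_size h" for v
    by (rule clump_count_cong[OF L]) (use eq le[OF that] in auto)
  have sel: "\<sigma> (sel L v) = \<tau> (sel L v)" if "v < tree_size h" for v
    using eq le[OF that] by (simp add: sel_def[OF L])
  have nodes: "u < tree_size h \<and> w < tree_size h" if "(u, w) \<in> tree_edges h 0" for u w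
    using tree_edges_bounds[OF that] by linarith
  have "(\<sigma> (sel L w) \<longrightarrow> clump_count L u \<sigma> + clump_count L w \<sigma> \<le> L) \<longleftrightarrow>
      (\<tau> (sel L w) \<longrightarrow> clump_count L u \<tau> + clump_count L w \<tau> \<le> L)"
    if "(u, w) \<in> tree_edges h 0" for u w
    using nodes[OF that] count sel by simp
  then have "(\<forall>(u, w)\<in>tree_edges h 0. \<sigma> (sel L w) \<longrightarrow> clump_count L u \<sigma> + clump_count L w \<sigma> \<le> L) \<longleftrightarrow>
      (\<forall>(u, w)\<in>tree_edges h 0. \<tau> (sel L w) \<longrightarrow> clump_count L u \<tau> + clump_count L w \<tau> \<le> L)"
    by (intro ball_cong refl) auto
  then show "tree_fun L h 0 0 \<sigma> = tree_fun L h 0 0 \<tau>"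
    using count[OF tree_size_pos] sel[OF tree_size_pos] unfolding tree_fun_def[OF L] by simp
qed

section \<open>Number of variables and numerical estimates\<close>

definition num_vars :: "nat \<Rightarrow> nat" where
  "num_vars h = tree_size h * Suc (2 * 2 ^ h)"

text \<open>Functions are to be indexed by their number of variables; injectivity recovers the
  height from it.\<close>

lemma strict_mono_num_vars: "strict_mono num_vars"
  unfolding strict_mono_Suc_iff
proof
  fix h
  have "tree_size h * Suc (2 * 2 ^ h) < tree_size (Suc h) * Suc (2 * 2 ^ h)"
    by (simp add: tree_size.simps(2) tree_size_pos)
  also have "\<dots> \<le> tree_size (Suc h) * Suc (2 * 2 ^ Suc h)"
    by simp
  finally show "num_vars h < num_vars (Suc h)" by (simp add: num_vars_def)
qed

text \<open>Powers of 3 are relaxed to powers of 4, which makes the bound a power of two and its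
  logarithm linear in h.\<close>

lemma num_vars_le: "num_vars h \<le> 2 ^ (3 * h + 3)"
proof -
  have "tree_size h + 1 \<le> 2 * 4 ^ h"
    by (induction h) (simp_all add: tree_size.simps(2))
  then have "num_vars h \<le> (2 * 4 ^ h) * (4 * 2 ^ h)"
    unfolding num_vars_def by (intro mult_le_mono) (simp_all add: Suc_le_eq)
  also have "\<dots> = 2 ^ (3 * h + 3)"
    by (simp add: power_add power_mult flip: power_mult_distrib)
  finally show ?thesis .
qed

text \<open>With n the number of variables, ln n <= 3h + 3 <= 6h, so (ln n)^2 <= 36 h^2. From ln 2
  >= 1/2 one gets ln s >= h^2 ln 2 / (2c) >= h^2 / (4c), and 36 / 144 = 1/4.\<close>

lemma num_vars_lower_bound:
  assumes c: "1 \<le> c" and h: "1 \<le> h" and s: "Suc (2 ^ h) ^ h \<le> s ^ (2 * c)"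
  shows "real (num_vars h) powr (1 / (144 * real c) * ln (real (num_vars h))) \<le> real s"
proof -
  have "s \<noteq> 0"
  proof
    assume "s = 0"
    then have "Suc (2 ^ h) ^ h = 0" using s c by (simp add: power_0_left)
    then show False by simp
  qed
  have pos: "0 < num_vars h" by (simp add: num_vars_def tree_size_pos)
  have "real (num_vars h) \<le> 2 ^ (3 * h + 3)"
    using num_vars_le[of h] by (simp flip: of_nat_le_iff)
  then have "ln (real (num_vars h)) \<le> real (3 * h + 3) * ln 2"
    using pos ln_le_cancel_iff[of "real (num_vars h)" "2 ^ (3 * h + 3)"] by (simp add: ln_realpow)
  also have "\<dots> \<le> real (3 * h + 3) * 1"
    using ln_le_minus_one[of "2 :: real"] by (intro mult_left_mono) auto
  also have "\<dots> \<le> 6 * real h" using h by simp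
  finally have "ln (real (num_vars h)) ^ 2 \<le> (6 * real h) ^ 2"
    using pos by (intro power_mono) auto
  then have "1 / (144 * real c) * ln (real (num_vars h)) ^ 2 \<le> 1 / (144 * real c) * (36 * real h ^ 2)"
    by (intro mult_left_mono) (auto simp: power_mult_distrib)
  also have "\<dots> = real h ^ 2 * (1 / 2) / (2 * real c)"
    using c by (simp add: field_simps)
  also have "\<dots> \<le> real h ^ 2 * ln 2 / (2 * real c)"
    using ln_le_minus_one[of "1 / 2 :: real"] by (intro divide_right_mono mult_left_mono) (auto simp: ln_div)
  also have "\<dots> \<le> ln (real s)"
  proof -
    have "(2 ^ h) ^ h \<le> Suc (2 ^ h) ^ h" by (intro power_mono) auto
    also note s
    finally have "(2 :: nat) ^ (h * h) \<le> s ^ (2 * c)"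
      by (simp only: power_mult)
    then have "real (2 ^ (h * h)) \<le> real (s ^ (2 * c))"
      by (simp only: of_nat_le_iff)
    then have "(2 :: real) ^ (h * h) \<le> real s ^ (2 * c)"
      by simp
    then have "ln ((2 :: real) ^ (h * h)) \<le> ln (real s ^ (2 * c))"
      using \<open>s \<noteq> 0\<close> by (subst ln_le_cancel_iff) auto
    then have "real h ^ 2 * ln 2 \<le> 2 * real c * ln (real s)"
      using \<open>s \<noteq> 0\<close> by (simp add: ln_realpow power2_eq_square)
    then show ?thesis using c by (simp add: divide_le_eq mult.commute)
  qed
  finally have "exp (1 / (144 * real c) * ln (real (num_vars h)) ^ 2) \<le> exp (ln (real s))"
    by simp
  then show ?thesis
    using pos \<open>s \<noteq> 0\<close> by (simp add: powr_def power2_eq_square mult.assoc)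
qed

theorem theorem3:
  fixes c :: nat
  assumes "c \<ge> 1"
  shows "\<exists>(F :: nat \<Rightarrow> (nat \<Rightarrow> bool) \<Rightarrow> bool) (N :: nat set).
     infinite N \<and>
     (\<forall>n\<in>N. depends_only_on {0..<n} (F n)) \<and>
     (\<exists>C :: real. \<exists>n0. \<forall>n\<in>N. n \<ge> n0 \<longrightarrow>
        (\<exists>T \<alpha>. vtree_over T {0..<n} \<and> sdd_respects T \<alpha> \<and> (\<forall>\<sigma>. sdd_eval \<alpha> \<sigma> = F n \<sigma>) \<and>
               real (sdd_size \<alpha>) \<le> C * real n ^ 3)) \<and>
     (\<exists>\<delta> :: real. \<delta> > 0 \<and> (\<exists>n0. \<forall>n\<in>N. n \<ge> n0 \<longrightarrow>
        (\<forall>B. c_nsobdd c B \<and> nbp_computes B {0..<n} (F n) \<longrightarrow>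
               real (nbp_size B) \<ge> real n powr (\<delta> * ln (real n)))))"
proof -
  \<comment> \<open>Outside the range of \<open>num_vars\<close> the inverse is arbitrary; such n do
    not belong to \<open>N\<close>.\<close>
  define F where "F n = tree_fun (2 ^ inv num_vars n) (inv num_vars n) 0 0" for n
  have F: "F (num_vars h) = tree_fun (2 ^ h) h 0 0" for h
    by (simp add: F_def inv_f_f strict_mono_imp_inj_on strict_mono_num_vars)
  \<comment> \<open>Height 0 is left out: a tree without edges has no crossing matching, and 3h + 3
    <= 6h needs h >= 1.\<close>
  define N where "N = num_vars ` {1..}"
  have inf: "infinite N"
    unfolding N_def using strict_mono_imp_inj_on[OF strict_mono_num_vars]
    by (metis finite_imageD infinite_Ici)
  have dep: "depends_only_on {0..<n} (F n)" if n: "n \<in> N" for n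
  proof -
    obtain h where n: "n = num_vars h" using n unfolding N_def by blast
    show ?thesis unfolding n F using depends_tree_fun[of "2 ^ h" h] by (simp add: num_vars_def)
  qed
  have upper: "\<exists>T \<alpha>. vtree_over T {0..<n} \<and> sdd_respects T \<alpha> \<and> (\<forall>\<sigma>. sdd_eval \<alpha> \<sigma> = F n \<sigma>) \<and>
      real (sdd_size \<alpha>) \<le> 16 * real n ^ 3" if n: "n \<in> N" for n
  proof -
    obtain h where n: "n = num_vars h" using n unfolding N_def by blast
    let ?L = "2 ^ h :: nat"
    have L: "0 < ?L" by simp
    have "sdd_size (tree_sdd ?L h 0 0 True) \<le> 16 * Suc (2 * ?L) ^ 2 * tree_size h"
      by (rule sdd_size_tree) simp_all
    \<comment> \<open>The factors missing from the cube of n are at least 1.\<close>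
    also have "\<dots> \<le> 16 * Suc (2 * ?L) ^ 2 * tree_size h * (Suc (2 * ?L) * tree_size h ^ 2)"
      by (simp add: tree_size_pos Suc_le_eq)
    also have "\<dots> = 16 * n ^ 3"
      by (simp only: n num_vars_def power_mult_distrib power2_eq_square power3_eq_cube mult_ac)
    finally have "real (sdd_size (tree_sdd ?L h 0 0 True)) \<le> 16 * real n ^ 3"
      by (metis of_nat_le_iff of_nat_mult of_nat_numeral of_nat_power)
    moreover have "vtree_over (tree_vtree ?L h 0) {0..<n}"
      unfolding n num_vars_def by (rule vtree_over_tree_vtree[OF L])
    moreover have "sdd_respects (tree_vtree ?L h 0) (tree_sdd ?L h 0 0 True)"
      by (rule sdd_respects_tree[OF L])
    moreover have "\<forall>\<sigma>. sdd_eval (tree_sdd ?L h 0 0 True) \<sigma> = F n \<sigma>"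
      unfolding n F by (simp add: sdd_eval_tree[OF L])
    ultimately show ?thesis by blast
  qed
  have lower: "real n powr (1 / (144 * real c) * ln (real n)) \<le> real (nbp_size B)"
    if n: "n \<in> N" and B: "c_nsobdd c B" "nbp_computes B {0..<n} (F n)" for n B
  proof -
    obtain h where n: "n = num_vars (Suc h)"
      using n unfolding N_def by (metis Suc_le_D One_nat_def atLeast_iff imageE)
    have "Suc (2 ^ Suc h) ^ Suc h \<le> nbp_size B ^ (2 * c)"
      by (rule tree_fun_lower_bound[OF _ B(1)]) (use B(2) in \<open>simp_all only: n F, simp\<close>)
    then show ?thesis unfolding n by (rule num_vars_lower_bound[OF assms, rotated]) simp
  qed
  have "\<forall>n\<in>N. 0 \<le> n \<longrightarrow>
      (\<exists>T \<alpha>. vtree_over T {0..<n} \<and> sdd_respects T \<alpha> \<and> (\<forall>\<sigma>. sdd_eval \<alpha> \<sigma> = F n \<sigma>) \<and>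
         real (sdd_size \<alpha>) \<le> 16 * real n ^ 3)"
    by (intro ballI impI upper)
  moreover have "\<forall>n\<in>N. 0 \<le> n \<longrightarrow>
      (\<forall>B. c_nsobdd c B \<and> nbp_computes B {0..<n} (F n) \<longrightarrow>
         real (nbp_size B) \<ge> real n powr (1 / (144 * real c) * ln (real n)))"
    by (intro ballI impI allI lower) simp_all
  moreover have "0 < 1 / (144 * real c)" using assms by simp
  ultimately show ?thesis
    using inf dep by (intro exI[of _ F] exI[of _ N] conjI ballI; (assumption | fast)?)
qed

end
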